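(* Let $X'$ be a Hadamard space and $X\subset X'$ a closed convex subset. Let $o\in X$, let $\eta\in\partial_\infty X'$, let $\rho:=\overline{o\eta}$ be the ray from $o$ to $\eta$, and let $\mathrm{pr}:X'\to X$ be the nearest point projection. (1) If $\angle(\eta,\partial_\infty X)<\frac{\pi}{2}$, then, as $t\to\infty$, the segments $\overline{o\,\mathrm{pr}(\rho(t))}$ converge in the cone topology to the ray $\overline{o\xi}$, where $\xi\in\partial_\infty X$ is the unique point with $\angle(\eta,\xi)=\angle(\eta,\partial_\infty X)$. (2) If the projection $\mathrm{pr}\circ\rho$ of the ray $\overline{o\eta}$ to $X$ is bounded, then there exists a point $p\in X$ such that $\mathrm{pr}(\overline{p\eta}(t))=p$ for all $t>0$.
   Context: A Hadamard space is a complete CAT(0) space. Rays and segments have unit speed. $\partial_\infty X'$ is the set of equivalence classes of rays in $X'$, two rays being equivalent if they have bounded distance; $\partial_\infty X\subset\partial_\infty X'$ is the set of classes of rays contained in $X$. For $p\in X'$ and $\eta\in\partial_\infty X'$, $\overline{p\eta}$ is the unique ray from $p$ in the class $\eta$ and $\overline{p\eta}(t)$ its point at distance $t$ from $p$. $\angle(\eta,\xi)\in[0,\pi]$ denotes the Tits angle between boundary points, $\angle(\eta,\xi)=\lim_{t,t'\to\infty}\tilde\angle_o(\overline{o\eta}(t),\overline{o\xi}(t'))$, with $\tilde\angle_o$ the Euclidean comparison angle at $o$ (independent of $o$), and $\angle(\eta,\partial_\infty X)=\inf_{\xi\in\partial_\infty X}\angle(\eta,\xi)$. Convergence of segments $\overline{op_t}$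 to a ray $\overline{o\xi}$ in the cone topology means that $d(o,p_t)\to\infty$ and $\overline{op_t}(s)\to\overline{o\xi}(s)$ for each $s\ge0$ (uniformly on bounded intervals of $s$). *)

theory Defs
  imports "HOL-Analysis.Analysis"
begin

section \<open>Hadamard spaces\<close>

text \<open>A segment is a unit speed map on the interval from 0 to \<^term>\<open>dist x y\<close>,
  represented by a total function whose values outside this interval are irrelevant.\<close>

definition (in metric_space) segment_between :: "'a \<Rightarrow> 'a \<Rightarrow> (real \<Rightarrow> 'a) \<Rightarrow> bool" where
  "segment_between x y c \<longleftrightarrow> c 0 = x \<and> c (dist x y) = y \<and>
     (\<forall>s\<in>{0..dist x y}. \<forall>t\<in>{0..dist x y}. dist (c s) (c t) = \<bar>s - t\<bar>)"

text \<open>The CAT(0) inequality compares two points of a geodesic triangle with the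
  corresponding points of a Euclidean comparison triangle \<open>P Q R\<close>. Points on the same side
  satisfy it trivially, and two different sides share a vertex, which is called \<open>p\<close> here.
  The third side exists by the first axiom and does not enter the inequality.\<close>

class CAT0_space = metric_space +
  assumes ex_segment: "\<exists>c. segment_between x y c"
    and CAT0_inequality:
      "\<lbrakk>segment_between p q c; segment_between p r c';
        dist (P :: real ^ 2) Q = dist p q; dist P R = dist p r; dist Q R = dist q r;
        s \<in> {0..dist p q}; X \<in> closed_segment P Q; dist P X = s;
        t \<in> {0..dist p r}; Y \<in> closed_segment P R; dist P Y = t\<rbrakk>
       \<Longrightarrow> dist (c s) (c' t) \<le> dist X Y"

class hadamard_space = CAT0_space + complete_space

text \<open>The segment \<open>seg x y\<close> is unique on the interval from 0 to \<^term>\<open>dist x y\<close>.\<close>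

definition seg :: "'a::hadamard_space \<Rightarrow> 'a \<Rightarrow> real \<Rightarrow> 'a" where
  "seg x y = (SOME c. segment_between x y c)"

definition geodesically_convex :: "'a::hadamard_space set \<Rightarrow> bool" where
  "geodesically_convex S \<longleftrightarrow>
     (\<forall>x\<in>S. \<forall>y\<in>S. \<forall>c. segment_between x y c \<longrightarrow> c ` {0..dist x y} \<subseteq> S)"

definition nearest_point :: "'a::hadamard_space set \<Rightarrow> 'a \<Rightarrow> 'a" where
  "nearest_point S x = (THE y. y \<in> S \<and> (\<forall>z\<in>S. dist x y \<le> dist x z))"

section \<open>The boundary at infinity\<close>

definition is_ray :: "(real \<Rightarrow> 'a::hadamard_space) \<Rightarrow> bool" where
  "is_ray r \<longleftrightarrow> (\<forall>s\<ge>0. \<forall>t\<ge>0. dist (r s) (r t) = \<bar>s - t\<bar>)"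

definition asymptotic :: "(real \<Rightarrow> 'a::hadamard_space) rel" where
  "asymptotic = {(r, r'). is_ray r \<and> is_ray r' \<and> (\<exists>C. \<forall>t\<ge>0. dist (r t) (r' t) \<le> C)}"

text \<open>For a subset \<open>S\<close> these are the classes, in the whole space, of the rays contained in \<open>S\<close>;
  the boundary of the whole space is obtained for \<^term>\<open>UNIV\<close>.\<close>

definition ideal_boundary :: "'a::hadamard_space set \<Rightarrow> (real \<Rightarrow> 'a) set set" where
  "ideal_boundary S = {r. is_ray r \<and> r ` {0..} \<subseteq> S} // asymptotic"

text \<open>The ray from \<open>p\<close> in the class \<open>\<eta>\<close> is unique as a function of nonnegative parameters.\<close>

definition ray_from :: "'a::hadamard_space \<Rightarrow> (real \<Rightarrow> 'a) set \<Rightarrow> real \<Rightarrow> 'a" where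
  "ray_from p \<eta> = (SOME r. r \<in> \<eta> \<and> r 0 = p)"

text \<open>Law of cosines; used only for \<open>x\<close> and \<open>y\<close> different from \<open>p\<close>.\<close>

definition comparison_angle :: "'a::metric_space \<Rightarrow> 'a \<Rightarrow> 'a \<Rightarrow> real" where
  "comparison_angle p x y =
     arccos (((dist p x)\<^sup>2 + (dist p y)\<^sup>2 - (dist x y)\<^sup>2) / (2 * dist p x * dist p y))"

definition tits_angle :: "(real \<Rightarrow> 'a::hadamard_space) set \<Rightarrow> (real \<Rightarrow> 'a) set \<Rightarrow> real" where
  "tits_angle \<eta> \<xi> = (THE a. \<forall>p.
     ((\<lambda>(t, t'). comparison_angle p (ray_from p \<eta> t) (ray_from p \<xi> t')) \<longlongrightarrow> a)
       (at_top \<times>\<^sub>F at_top))"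

text \<open>Extended real values make the infimum over the empty set infinite.\<close>

definition tits_angle_to_set ::
    "(real \<Rightarrow> 'a::hadamard_space) set \<Rightarrow> (real \<Rightarrow> 'a) set set \<Rightarrow> ereal" where
  "tits_angle_to_set \<eta> B = (INF \<xi>\<in>B. ereal (tits_angle \<eta> \<xi>))"

text \<open>Cone topology convergence, as \<open>t\<close> tends to infinity, of the segments from \<open>p\<close> to \<open>f t\<close>
  to the ray from \<open>p\<close> in the class \<open>\<xi>\<close>. The segment is evaluated at parameters up to \<open>T\<close>,
  which are less than its length for all large \<open>t\<close> because of the first condition.\<close>

definition segments_converge_to_ray ::
    "'a::hadamard_space \<Rightarrow> (real \<Rightarrow> 'a) \<Rightarrow> (real \<Rightarrow> 'a) set \<Rightarrow> bool" where
  "segments_converge_to_ray p f \<xi> \<longleftrightarrow>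
     filterlim (\<lambda>t. dist p (f t)) at_top at_top \<and>
     (\<forall>T\<ge>0. uniform_limit {0..T} (\<lambda>t. seg p (f t)) (ray_from p \<xi>) at_top)"

end

theory Submission imports Defs "HOL-Real_Asymp.Real_Asymp" begin

text \<open>Write \<open>\<rho>\<close> for the ray, \<open>p\<^sub>t\<close> for the projection of \<open>\<rho> t\<close> to \<open>X\<close> and \<open>h\<^sub>t\<close> for its distance
  from \<open>\<rho> t\<close>. If some ray in \<open>X\<close> makes an angle less than a right angle with \<open>\<rho>\<close>, then
  \<open>h\<^sub>t / t\<close>, which increases by convexity, stays below a constant less than 1. For \<open>s \<le> t\<close> the point
  \<open>y\<close> dividing the segment from \<open>o\<close> to \<open>p\<^sub>t\<close> in the ratio \<open>s / t\<close> has distance at most \<open>s h\<^sub>t / t\<close>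
  from \<open>\<rho> s\<close>, so the projection inequality at \<open>\<rho> s\<close> gives
  \<open>d(y, p\<^sub>s)\<^sup>2 \<le> s\<^sup>2 ((h\<^sub>t / t)\<^sup>2 - (h\<^sub>s / s)\<^sup>2)\<close>. Hence the segments from \<open>o\<close> to \<open>p\<^sub>t\<close> converge
  to a ray whose distance from \<open>p\<^sub>s\<close> is sublinear. The same inequality, applied to the points at distance
  \<open>d(o, p\<^sub>s)\<close> from \<open>o\<close> on the rays in \<open>X\<close>, shows that this ray minimises the angle, and only this one.

  If the projections are bounded, then the Busemann function of \<open>\<rho>\<close> attains its infimum over \<open>X\<close>
  on a ball, because it is bounded on \<open>X\<close> from below by its infimum over the points \<open>p\<^sub>t\<close>.
  Along the ray from a minimum point the Busemann function drops at unit speed and it is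
  1-Lipschitz, so no point of \<open>X\<close> is nearer to that ray's points than its origin.\<close>

section \<open>Comparison inequalities\<close>

text \<open>The Euclidean inner product of the two sides at \<open>p\<close> of a comparison
  triangle, by polarisation. Unlike an angle it makes sense for degenerate triangles, and in the
  plane it scales bilinearly along the sides, so that the CAT(0) condition becomes a one-sided
  scaling law.\<close>

definition comparison_inner :: "'a::metric_space \<Rightarrow> 'a \<Rightarrow> 'a \<Rightarrow> real" where
  "comparison_inner p x y = ((dist p x)\<^sup>2 + (dist p y)\<^sup>2 - (dist x y)\<^sup>2) / 2"

lemma comparison_inner_commute: "comparison_inner p x y = comparison_inner p y x"
  by (simp add: comparison_inner_def dist_commute)

lemma dist_sq_comparison_inner:
  "(dist x y)\<^sup>2 = (dist p x)\<^sup>2 + (dist p y)\<^sup>2 - 2 * comparison_inner p x y"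
  by (simp add: comparison_inner_def field_simps)

text \<open>Cauchy-Schwarz for comparison triangles: after polarisation the two bounds are the
  squares of the triangle inequalities.\<close>

lemma abs_comparison_inner_le:
  fixes p :: "'a::metric_space"
  shows "\<bar>comparison_inner p x y\<bar> \<le> dist p x * dist p y"
proof -
  have "\<bar>dist p x - dist p y\<bar> \<le> dist x y"
    by (metis abs_dist_diff_le dist_commute)
  then have "(dist p x - dist p y)\<^sup>2 \<le> (dist x y)\<^sup>2"
    by (metis abs_le_square_iff abs_of_nonneg zero_le_dist)
  moreover have "dist x y \<le> dist p x + dist p y"
    by (metis dist_commute dist_triangle)
  then have "(dist x y)\<^sup>2 \<le> (dist p x + dist p y)\<^sup>2"
    by (simp add: power_mono)
  ultimately show ?thesis
    by (simp add: comparison_inner_def abs_le_iff power2_sum power2_diff)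
qed

lemma segment_between_seg: "segment_between x y (seg x y)"
  for x y :: "'a::hadamard_space"
  unfolding seg_def using ex_segment by (rule someI_ex)

lemma segment_between_reverse:
  assumes "segment_between x y c"
  shows "segment_between y x (\<lambda>s. c (dist x y - s))"
  using assms by (auto simp: segment_between_def dist_commute)

lemma segment_between_dist:
  assumes "segment_between x y c" "0 \<le> s" "s \<le> dist x y"
  shows "dist x (c s) = s" "dist (c s) y = dist x y - s"
proof -
  have *: "s \<in> {0..dist x y}" "0 \<in> {0..dist x y}" "dist x y \<in> {0..dist x y}"
    using assms by auto
  have c: "c 0 = x" "c (dist x y) = y"
    and d: "\<And>s t. s \<in> {0..dist x y} \<Longrightarrow> t \<in> {0..dist x y} \<Longrightarrow> dist (c s) (c t) = \<bar>s - t\<bar>"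
    using assms(1) by (auto simp: segment_between_def)
  show "dist x (c s) = s" using d[OF *(2,1)] c assms by simp
  show "dist (c s) y = dist x y - s" using d[OF *(1,3)] c assms by simp
qed

text \<open>With \<open>p\<close> at the origin and \<open>Q\<close> on the first axis, the inner
  product dictates the first coordinate \<open>u\<close> of \<open>R\<close>, and the length of
  \<open>R\<close> dictates the second. Cauchy-Schwarz makes the square root real.\<close>

lemma ex_comparison_triangle:
  fixes p q r :: "'a::metric_space"
  assumes "p \<noteq> q"
  obtains Q R :: "real ^ 2" where "norm Q = dist p q" "norm R = dist p r" "dist Q R = dist q r"
proof -
  define a b u where "a = dist p q" "b = dist p r" "u = comparison_inner p q r / dist p q"
  have a: "a > 0" using assms by (simp add: a_b_u_def)
  have "\<bar>u\<bar> \<le> b"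
    using abs_comparison_inner_le[of p q r] a
    by (simp add: a_b_u_def abs_divide pos_divide_le_eq mult.commute)
  then have u: "u\<^sup>2 \<le> b\<^sup>2" 
    using abs_le_square_iff[of u b] by (simp add: a_b_u_def)
  define Q R :: "real ^ 2" where "Q = vector [a, 0]" "R = vector [u, sqrt (b\<^sup>2 - u\<^sup>2)]"
  have n: "norm (vector [x, y] :: real ^ 2) = sqrt (x\<^sup>2 + y\<^sup>2)" for x y :: real
    by (simp add: norm_vec_def L2_set_def sum_2)
  have "Q - R = vector [a - u, - sqrt (b\<^sup>2 - u\<^sup>2)]"
    by (simp add: Q_R_def vec_eq_iff forall_2)
  then have "dist Q R = sqrt ((a - u)\<^sup>2 + (b\<^sup>2 - u\<^sup>2))"
    using u by (simp add: dist_norm n)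
  also have "(a - u)\<^sup>2 + (b\<^sup>2 - u\<^sup>2) = (dist q r)\<^sup>2"
  proof -
    have "a * u = comparison_inner p q r" using a by (simp add: a_b_u_def)
    then show ?thesis
      using assms dist_sq_comparison_inner[of q r p] by (simp add: power2_diff a_b_u_def)
  qed
  finally have "dist Q R = dist q r" by simp
  moreover have "norm Q = dist p q" "norm R = dist p r"
    using u a by (simp_all add: Q_R_def n a_b_u_def)
  ultimately show ?thesis using that by blast
qed

text \<open>In the Euclidean triangle, scaling one side by \<open>l\<close> scales the inner product
  by exactly \<open>l\<close>. By CAT(0) the distance to \<open>r\<close> can only be smaller than
  in the plane, hence the inner product only larger.\<close>

lemma comparison_inner_segment:
  fixes c :: "real \<Rightarrow> 'a::hadamard_space"
  assumes c: "segment_between p q c" and l: "0 \<le> l" "l \<le> 1"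
  shows "l * comparison_inner p q r \<le> comparison_inner p (c (l * dist p q)) r"
proof (cases "p = q")
  case True
  then have "c (l * dist p q) = p" using c by (simp add: segment_between_def)
  then show ?thesis using True by (simp add: comparison_inner_def dist_commute)
next
  case False
  then obtain Q R :: "real ^ 2"
    where *: "norm Q = dist p q" "norm R = dist p r" "dist Q R = dist q r"
    by (rule ex_comparison_triangle)
  have ld: "0 \<le> l * dist p q" "l * dist p q \<le> dist p q"
    using l by (auto simp: mult_left_le_one_le)
  have "l *\<^sub>R Q \<in> closed_segment 0 Q"
    using l by (auto simp: in_segment)
  moreover have "dist 0 (l *\<^sub>R Q) = l * dist p q"
    using l * by (simp add: dist_norm)
  \<comment> \<open>The second comparison point is the vertex \<open>R\<close> itself, so the axiom
    is used at the full parameter \<open>dist p r\<close>.\<close>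
  ultimately have "dist (c (l * dist p q)) (seg p r (dist p r)) \<le> dist (l *\<^sub>R Q) R"
    using * ld
    by (intro CAT0_inequality[OF c segment_between_seg[of p r], of 0 Q R]) 
       (auto simp: in_segment intro: exI[of _ 1])
  moreover have "seg p r (dist p r) = r"
    using segment_between_seg[of p r] by (simp add: segment_between_def)
  ultimately have "(dist (c (l * dist p q)) r)\<^sup>2 \<le> (dist (l *\<^sub>R Q) R)\<^sup>2"
    by (simp add: power_mono)
  also have "\<dots> = l\<^sup>2 * (dist p q)\<^sup>2 + (dist p r)\<^sup>2 - 2 * l * (Q \<bullet> R)"
    unfolding *[symmetric] dist_norm power2_norm_eq_inner
    by (simp add: inner_diff inner_commute power2_eq_square algebra_simps)
  also have "Q \<bullet> R = comparison_inner p q r"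
    unfolding comparison_inner_def *[symmetric] dist_norm power2_norm_eq_inner
    by (simp add: inner_diff inner_commute)
  finally show ?thesis
    using segment_between_dist(1)[OF c ld]
    by (simp add: comparison_inner_def[of p "c _"] power_mult_distrib)
qed

text \<open>The scaling law is used twice, the second time for the triangle whose first side is
  already shortened. For positive lengths this is the monotonicity of comparison angles.\<close>

lemma comparison_inner_segments:
  fixes c c' :: "real \<Rightarrow> 'a::hadamard_space"
  assumes "segment_between p q c" "segment_between p r c'"
    and "0 \<le> l" "l \<le> 1" "0 \<le> m" "m \<le> 1"
  shows "l * m * comparison_inner p q r
    \<le> comparison_inner p (c (l * dist p q)) (c' (m * dist p r))"
proof -
  have "m * (l * comparison_inner p q r) \<le> m * comparison_inner p (c (l * dist p q)) r"
    using comparison_inner_segment[OF assms(1,3,4), of r] assms by (simp add: mult_left_mono)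
  also have "\<dots> \<le> comparison_inner p (c' (m * dist p r)) (c (l * dist p q))"
    using comparison_inner_segment[OF assms(2,5,6), of "c (l * dist p q)"]
    by (simp add: comparison_inner_commute[of p _ "c (l * dist p q)"])
  finally show ?thesis by (simp add: comparison_inner_commute[of p _ "c (l * dist p q)"] mult_ac)
qed

text \<open>The scaling law at the vertex \<open>x\<close>, expanded; equality is Stewart's theorem
  in the plane. The negative term is the uniform convexity behind the Cauchy sequences and the
  projection inequality.\<close>

lemma stewart:
  fixes c :: "real \<Rightarrow> 'a::hadamard_space"
  assumes c: "segment_between x y c" and l: "0 \<le> l" "l \<le> 1"
  shows "(dist (c (l * dist x y)) z)\<^sup>2
    \<le> (1 - l) * (dist x z)\<^sup>2 + l * (dist y z)\<^sup>2 - l * (1 - l) * (dist x y)\<^sup>2"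
proof -
  have "0 \<le> l * dist x y" "l * dist x y \<le> dist x y"
    using l by (auto simp: mult_left_le_one_le)
  then have "dist x (c (l * dist x y)) = l * dist x y"
    using segment_between_dist[OF c] by blast
  then show ?thesis
    using comparison_inner_segment[OF assms, of z]
    by (simp add: comparison_inner_def field_simps power2_eq_square)
qed

text \<open>The intercept theorem as an inequality: the squares of both sides are multiplied by the
  square of \<open>l\<close>, and the inner product by at least this factor.\<close>

lemma thales:
  fixes c c' :: "real \<Rightarrow> 'a::hadamard_space"
  assumes c: "segment_between p q c" "segment_between p r c'" and l: "0 \<le> l" "l \<le> 1"
  shows "dist (c (l * dist p q)) (c' (l * dist p r)) \<le> l * dist q r"
proof -
  have "0 \<le> l * dist p q" "l * dist p q \<le> dist p q" "0 \<le> l * dist p r" "l * dist p r \<le> dist p r"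
    using l by (auto simp: mult_left_le_one_le)
  then have "dist p (c (l * dist p q)) = l * dist p q" "dist p (c' (l * dist p r)) = l * dist p r"
    using segment_between_dist c by blast+
  then have "(dist (c (l * dist p q)) (c' (l * dist p r)))\<^sup>2 \<le> (l * dist q r)\<^sup>2"
    using comparison_inner_segments[OF c l l]
    unfolding power_mult_distrib dist_sq_comparison_inner[of q r p]
      dist_sq_comparison_inner[of "c _" "c' _" p]
    by (simp add: power_mult_distrib power2_eq_square[of l] right_diff_distrib distrib_left)
  then show ?thesis by (rule power2_le_imp_le) (use l in simp)
qed

text \<open>The square of the right side exceeds Stewart's bound by \<open>l * (1 - l)\<close> times
  the difference of the squares of \<open>dist x y\<close> and \<open>dist x z - dist y z\<close>,
  which the triangle inequality makes nonnegative.\<close>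

lemma dist_segment_convex:
  fixes c :: "real \<Rightarrow> 'a::hadamard_space"
  assumes c: "segment_between x y c" and l: "0 \<le> l" "l \<le> 1"
  shows "dist (c (l * dist x y)) z \<le> (1 - l) * dist x z + l * dist y z"
proof (rule power2_le_imp_le)
  have "\<bar>dist x z - dist y z\<bar> \<le> dist x y"
    using abs_dist_diff_le[of x z y] by (simp add: dist_commute)
  then have "(dist x z - dist y z)\<^sup>2 \<le> (dist x y)\<^sup>2"
    by (metis abs_le_square_iff abs_of_nonneg zero_le_dist)
  then have "l * (1 - l) * (dist x z - dist y z)\<^sup>2 \<le> l * (1 - l) * (dist x y)\<^sup>2"
    using l by (intro mult_left_mono) auto
  then show "(dist (c (l * dist x y)) z)\<^sup>2 \<le> ((1 - l) * dist x z + l * dist y z)\<^sup>2"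
    using stewart[OF assms, of z] by (simp add: power2_eq_square algebra_simps)
  show "0 \<le> (1 - l) * dist x z + l * dist y z" using l by simp
qed

section \<open>Minimisation on convex sets\<close>

definition midpt :: "'a::hadamard_space \<Rightarrow> 'a \<Rightarrow> 'a" where
  "midpt x y = seg x y (1 / 2 * dist x y)"

lemma midpt_sq_le:
  "(dist (midpt x y) z)\<^sup>2 \<le> (dist x z)\<^sup>2 / 2 + (dist y z)\<^sup>2 / 2 - (dist x y)\<^sup>2 / 4"
  using stewart[OF segment_between_seg[of x y], of "1 / 2" z] by (simp add: midpt_def)

lemma midpt_le: "dist (midpt x y) z \<le> (dist x z + dist y z) / 2"
  using dist_segment_convex[OF segment_between_seg[of x y], of "1 / 2" z]
  by (simp add: midpt_def field_simps)

lemma geodesically_convex_segment: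
  assumes "geodesically_convex X" "x \<in> X" "y \<in> X" "segment_between x y c" "0 \<le> s" "s \<le> dist x y"
  shows "c s \<in> X"
proof -
  have "c ` {0..dist x y} \<subseteq> X" using assms by (simp add: geodesically_convex_def)
  then show ?thesis using assms by (simp add: image_subset_iff)
qed

lemma geodesically_convex_midpt:
  assumes "geodesically_convex X" "x \<in> X" "y \<in> X"
  shows "midpt x y \<in> X"
  unfolding midpt_def
  by (rule geodesically_convex_segment[OF assms segment_between_seg]) auto

text \<open>The sequence of almost nearest points to a base point is Cauchy.\<close>

lemma nested_midpoint_convex_Inter:
  fixes C :: "nat \<Rightarrow> 'a::hadamard_space set"
  assumes cl: "\<And>n. closed (C n)" and ne: "\<And>n. C n \<noteq> {}" and dec: "decseq C"
    and bd: "bounded (C 0)"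
    and mid: "\<And>n x y. x \<in> C n \<Longrightarrow> y \<in> C n \<Longrightarrow> midpt x y \<in> C n"
  shows "(\<Inter>n. C n) \<noteq> {}"
proof -
  obtain o' :: 'a where True by blast
  define d where "d n = infdist o' (C n)" for n
  have sub: "C m \<subseteq> C n" if "n \<le> m" for m n using dec that by (simp add: decseq_def)
  have d0: "0 \<le> d n" for n by (simp add: d_def infdist_nonneg)
  have "\<exists>z\<in>C n. dist o' z < d n + 1 / Suc n" for n
  proof -
    have "(INF a\<in>C n. dist o' a) < d n + 1 / Suc n"
      by (simp add: d_def infdist_notempty ne)
    moreover have "bdd_below (dist o' ` C n)" by (auto intro: bdd_belowI[of _ 0])
    ultimately show ?thesis using cINF_less_iff[OF ne] by blast
  qed
  then obtain z where z: "\<And>n. z n \<in> C n" and zd: "\<And>n. dist o' (z n) < d n + 1 / Suc n"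
    by metis
  have "incseq d"
    unfolding incseq_def d_def using sub ne by (metis infdist_mono)
  obtain K where K: "\<And>x. x \<in> C 0 \<Longrightarrow> dist o' x \<le> K"
    using bd by (auto simp: bounded_any_center[of _ o'])
  have "d n \<le> K" for n
    using infdist_le[OF z[of n], of o'] K[of "z n"] z[of n] sub[of 0 n] unfolding d_def by force
  then obtain L where L: "d \<longlonglongrightarrow> L"
    using incseq_convergent[OF \<open>incseq d\<close>] by metis
  have zL: "(\<lambda>n. dist o' (z n)) \<longlonglongrightarrow> L"
  proof (rule tendsto_sandwich[OF _ _ L])
    show "\<forall>\<^sub>F n in sequentially. d n \<le> dist o' (z n)"
      by (simp add: d_def infdist_le z)
    show "\<forall>\<^sub>F n in sequentially. dist o' (z n) \<le> d n + 1 / Suc n"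
      using zd by (auto intro!: always_eventually less_imp_le)
    show "(\<lambda>n. d n + 1 / Suc n) \<longlonglongrightarrow> L"
      using tendsto_add[OF L LIMSEQ_Suc[OF lim_1_over_n]] by simp
  qed
  \<comment> \<open>Both points lie in the larger set \<open>C n\<close>, hence so does their
    midpoint, which is then at least \<open>d n\<close> away from \<open>o'\<close>. The midpoint
    inequality turns this into a bound on their distance.\<close>
  have key: "(dist (z n) (z m))\<^sup>2 \<le> 2 * (dist o' (z n))\<^sup>2 + 2 * (dist o' (z m))\<^sup>2 - 4 * (d n)\<^sup>2"
    if "n \<le> m" for n m
  proof -
    have "midpt (z n) (z m) \<in> C n" using z sub[OF that] mid by blast
    then have "d n \<le> dist (midpt (z n) (z m)) o'"
      unfolding d_def by (metis infdist_le dist_commute)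
    then have "(d n)\<^sup>2 \<le> (dist (midpt (z n) (z m)) o')\<^sup>2"
      using d0 by (simp add: power_mono)
    then show ?thesis using midpt_sq_le[of "z n" "z m" o'] by (simp add: dist_commute)
  qed
  have "Cauchy z"
    unfolding Cauchy_altdef2
  proof (intro allI impI)
    fix e :: real assume e: "e > 0"
    have "(\<lambda>n. (dist o' (z n))\<^sup>2) \<longlonglongrightarrow> L\<^sup>2" "(\<lambda>n. (d n)\<^sup>2) \<longlonglongrightarrow> L\<^sup>2"
      by (intro tendsto_intros zL L)+
    \<comment> \<open>The fraction is one eighth because \<open>key\<close> weighs the three squares
      with 2 + 2 + 4.\<close>
    then have "\<forall>\<^sub>F n in sequentially. (dist o' (z n))\<^sup>2 < L\<^sup>2 + e\<^sup>2 / 8 \<and> (d n)\<^sup>2 > L\<^sup>2 - e\<^sup>2 / 8"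
      using e by (intro eventually_conj order_tendstoD) auto
    then obtain N where N: "\<And>n. n \<ge> N \<Longrightarrow> (dist o' (z n))\<^sup>2 < L\<^sup>2 + e\<^sup>2 / 8"
        "\<And>n. n \<ge> N \<Longrightarrow> (d n)\<^sup>2 > L\<^sup>2 - e\<^sup>2 / 8"
      unfolding eventually_sequentially by blast
    have "dist (z m) (z N) < e" if "m \<ge> N" for m
    proof (rule power_less_imp_less_base)
      show "(dist (z m) (z N))\<^sup>2 < e\<^sup>2"
        using key[OF that] N(1)[of N] N(2)[of N] N(1)[OF that] by (simp add: dist_commute)
    qed (use e in simp)
    then show "\<exists>N. \<forall>n\<ge>N. dist (z n) (z N) < e" by blast
  qed
  then obtain w where w: "z \<longlonglongrightarrow> w" using Cauchy_convergent convergent_def by blast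
  have "w \<in> C n" for n
  proof (rule closed_sequentially[OF cl])
    show "z (k + n) \<in> C n" for k using z sub le_add2 by blast
    show "(\<lambda>k. z (k + n)) \<longlonglongrightarrow> w" using w by (rule LIMSEQ_ignore_initial_segment)
  qed
  then show ?thesis by blast
qed

text \<open>A substitute for compactness: the sublevel sets at heights decreasing to the infimum are
  nested, closed, bounded and closed under midpoints, so they have a common point. It serves both
  distance functions and Busemann functions.\<close>

lemma quasiconvex_attains_min:
  fixes X :: "'a::hadamard_space set" and f :: "'a \<Rightarrow> real"
  assumes X: "closed X" "X \<noteq> {}" "bounded X" "\<And>x y. x \<in> X \<Longrightarrow> y \<in> X \<Longrightarrow> midpt x y \<in> X"
    and f: "continuous_on UNIV f" "bdd_below (f ` X)"
    and mid: "\<And>x y. f (midpt x y) \<le> max (f x) (f y)"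
  obtains p where "p \<in> X" "\<And>x. x \<in> X \<Longrightarrow> f p \<le> f x"
proof -
  define m where "m = (INF x\<in>X. f x)"
  define C where "C n = X \<inter> {x. f x \<le> m + 1 / Suc n}" for n
  have "(\<Inter>n. C n) \<noteq> {}"
  proof (rule nested_midpoint_convex_Inter)
    show "closed (C n)" for n
      unfolding C_def by (intro closed_Int X closed_Collect_le f continuous_on_const)
    show "C n \<noteq> {}" for n
    proof -
      have "(INF x\<in>X. f x) < m + 1 / Suc n" by (simp add: m_def)
      then show ?thesis
        unfolding cINF_less_iff[OF X(2) f(2)] C_def using less_imp_le by blast
    qed
    show "decseq C"
      unfolding decseq_def C_def by (auto elim!: order_trans intro!: divide_left_mono)
    show "bounded (C 0)" using X by (auto simp: C_def intro: bounded_subset)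
    show "midpt x y \<in> C n" if "x \<in> C n" "y \<in> C n" for n x y
      using that X mid[of x y] by (auto simp: C_def)
  qed
  then obtain p where p: "\<And>n. p \<in> C n" by blast
  have "f p \<le> m"
  proof (rule LIMSEQ_le_const)
    show "(\<lambda>n. m + 1 / Suc n) \<longlonglongrightarrow> m"
      using tendsto_add[OF tendsto_const LIMSEQ_Suc[OF lim_1_over_n], of m] by simp
    show "\<exists>N. \<forall>n\<ge>N. f p \<le> m + 1 / Suc n" using p by (auto simp: C_def)
  qed
  moreover have "m \<le> f x" if "x \<in> X" for x
    unfolding m_def using f that by (intro cINF_lower) auto
  ultimately have "f p \<le> f x" if "x \<in> X" for x using that by (meson order_trans)
  moreover have "p \<in> X" using p[of 0] by (simp add: C_def)
  ultimately show ?thesis using that by blast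
qed

section \<open>The nearest point projection\<close>

text \<open>Moving from \<open>y\<close> a fraction \<open>l\<close> towards \<open>z\<close> cannot
  bring one nearer to \<open>x\<close>. Stewart's inequality for this point, divided by
  \<open>l\<close>, gives the claim as \<open>l\<close> tends to 0.\<close>

lemma nearest_pythagoras:
  fixes X :: "'a::hadamard_space set"
  assumes X: "geodesically_convex X" and y: "y \<in> X" "\<And>z. z \<in> X \<Longrightarrow> dist x y \<le> dist x z"
    and z: "z \<in> X"
  shows "(dist x y)\<^sup>2 + (dist y z)\<^sup>2 \<le> (dist x z)\<^sup>2"
proof -
  have *: "(dist x y)\<^sup>2 + (1 - l) * (dist y z)\<^sup>2 \<le> (dist x z)\<^sup>2" if l: "0 < l" "l < 1" for l
  proof -
    have "seg y z (l * dist y z) \<in> X"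
      using l by (intro geodesically_convex_segment[OF X y(1) z segment_between_seg])
        (auto simp: mult_left_le_one_le)
    then have "(dist x y)\<^sup>2 \<le> (dist (seg y z (l * dist y z)) x)\<^sup>2"
      using y(2)[of "seg y z (l * dist y z)"] by (simp add: dist_commute power_mono)
    also have "\<dots> \<le> (1 - l) * (dist x y)\<^sup>2 + l * (dist x z)\<^sup>2 - l * (1 - l) * (dist y z)\<^sup>2"
      using stewart[OF segment_between_seg, of l y z x] l by (simp add: dist_commute)
    finally have "l * ((dist x y)\<^sup>2 + (1 - l) * (dist y z)\<^sup>2) \<le> l * (dist x z)\<^sup>2"
      by (simp add: algebra_simps)
    then show ?thesis using l by simp
  qed
  have "((\<lambda>l. (dist x y)\<^sup>2 + (1 - l) * (dist y z)\<^sup>2) \<longlongrightarrow> (dist x y)\<^sup>2 + (1 - 0) * (dist y z)\<^sup>2) (at_right 0)"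
    by (intro tendsto_intros)
  moreover have "\<forall>\<^sub>F l in at_right 0. (dist x y)\<^sup>2 + (1 - l) * (dist y z)\<^sup>2 \<le> (dist x z)\<^sup>2"
    using eventually_at_right_less[of 0] eventually_at_right_real[of 0 1]
    by (auto elim!: eventually_mono intro!: *)
  ultimately show ?thesis
    using tendsto_upperbound[of _ _ "at_right (0::real)"] by force
qed

text \<open>The projection inequality forces two minimisers to coincide, so the definite description
  is proper.\<close>

lemma nearest_point_eqI:
  fixes X :: "'a::hadamard_space set"
  assumes "geodesically_convex X" "y \<in> X" "\<And>z. z \<in> X \<Longrightarrow> dist x y \<le> dist x z"
  shows "nearest_point X x = y"
  unfolding nearest_point_def
proof (rule the_equality)
  show "y \<in> X \<and> (\<forall>z\<in>X. dist x y \<le> dist x z)" using assms by blast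
  fix z assume z: "z \<in> X \<and> (\<forall>w\<in>X. dist x z \<le> dist x w)"
  then have "dist x z = dist x y" using assms by (meson order_antisym)
  moreover have "(dist x y)\<^sup>2 + (dist y z)\<^sup>2 \<le> (dist x z)\<^sup>2"
    using z by (intro nearest_pythagoras[OF assms]) auto
  ultimately have "(dist y z)\<^sup>2 \<le> 0" by simp
  then show "z = y" by simp
qed

lemma nearest_point:
  fixes X :: "'a::hadamard_space set"
  assumes X: "closed X" "geodesically_convex X" "X \<noteq> {}"
  shows "nearest_point X x \<in> X" "\<And>z. z \<in> X \<Longrightarrow> dist x (nearest_point X x) \<le> dist x z"
proof -
  obtain a where a: "a \<in> X" using X by blast
  have q: "dist x (midpt y z) \<le> max (dist x y) (dist x z)" for y z
    using midpt_le[of y z x] by (simp add: dist_commute max_def)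
  \<comment> \<open>The ball through an arbitrary point \<open>a\<close> of \<open>X\<close>
    supplies boundedness; points of \<open>X\<close> outside it are farther from \<open>x\<close>
    than \<open>a\<close> and cannot compete.\<close>
  obtain p where p: "p \<in> X \<inter> cball x (dist x a)"
      "\<And>z. z \<in> X \<inter> cball x (dist x a) \<Longrightarrow> dist x p \<le> dist x z"
  proof (rule quasiconvex_attains_min[of "X \<inter> cball x (dist x a)" "dist x"])
    show "midpt y z \<in> X \<inter> cball x (dist x a)"
      if "y \<in> X \<inter> cball x (dist x a)" "z \<in> X \<inter> cball x (dist x a)" for y z
      using that geodesically_convex_midpt[OF X(2), of y z] q[of y z] by auto
  qed (use X a q in \<open>auto intro!: bdd_belowI[of _ 0] continuous_intros\<close>)
  have "dist x p \<le> dist x z" if "z \<in> X" for z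
    using p(1) p(2)[of z] that by (cases "dist x z \<le> dist x a") auto
  moreover from this have "nearest_point X x = p"
    using p(1) nearest_point_eqI[OF X(2)] by blast
  ultimately show "nearest_point X x \<in> X" "\<And>z. z \<in> X \<Longrightarrow> dist x (nearest_point X x) \<le> dist x z"
    using p(1) by auto
qed
section \<open>Rays\<close>

lemma seg_endpoints: "seg x y 0 = x" "seg x y (dist x y) = y"
  using segment_between_seg[of x y] by (simp_all add: segment_between_def)

lemma is_ray_dist: "is_ray r \<Longrightarrow> 0 \<le> s \<Longrightarrow> 0 \<le> t \<Longrightarrow> dist (r s) (r t) = \<bar>s - t\<bar>"
  by (simp add: is_ray_def)

lemma is_ray_segment:
  assumes "is_ray r" "0 \<le> t"
  shows "segment_between (r 0) (r t) r"
  using assms by (simp add: is_ray_def segment_between_def)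

lemma ray_thales:
  assumes r: "is_ray r" "is_ray r'" "r 0 = r' 0" and st: "0 \<le> s" "s \<le> t" "0 < t"
  shows "dist (r s) (r' s) \<le> s / t * dist (r t) (r' t)"
proof -
  have "segment_between (r 0) (r t) r" "segment_between (r 0) (r' t) r'"
    using is_ray_segment[of r t] is_ray_segment[of r' t] r st by auto
  moreover have "dist (r 0) (r t) = t" "dist (r 0) (r' t) = t"
    using is_ray_dist[of r 0 t] is_ray_dist[of r' 0 t] r st by auto
  ultimately show ?thesis
    using thales[of "r 0" "r t" r "r' t" r' "s / t"] st by simp
qed

text \<open>The intercept inequality multiplies the bound \<open>C\<close> by \<open>s / t\<close>,
  and \<open>t\<close> is arbitrarily large.\<close>

lemma asymptotic_same_origin:
  assumes "(r, r') \<in> asymptotic" "r 0 = r' 0" "0 \<le> s"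
  shows "r s = r' s"
proof -
  obtain C where r: "is_ray r" "is_ray r'" and C: "\<And>t. t \<ge> 0 \<Longrightarrow> dist (r t) (r' t) \<le> C"
    using assms by (auto simp: asymptotic_def)
  have "((\<lambda>t. s * C / t) \<longlongrightarrow> 0) at_top" by real_asymp
  moreover have "\<forall>\<^sub>F t in at_top. dist (r s) (r' s) \<le> s * C / t"
    using eventually_ge_at_top[of s] eventually_gt_at_top[of 0]
  proof eventually_elim
    case (elim t)
    then have "s / t * dist (r t) (r' t) \<le> s / t * C"
      using assms C by (intro mult_left_mono) auto
    then show ?case using ray_thales[OF r assms(2,3), of t] elim by simp
  qed
  ultimately have "dist (r s) (r' s) \<le> 0" by (rule tendsto_lowerbound) simp
  then show ?thesis by simp
qed

lemma equiv_asymptotic: "equiv {r. is_ray r} (asymptotic :: (real \<Rightarrow> 'a::hadamard_space) rel)"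
  (is "equiv _ ?A")
proof (rule equivI)
  show "?A \<subseteq> {r. is_ray r} \<times> {r. is_ray r}" by (auto simp: asymptotic_def)
  show "refl_on {r. is_ray r} ?A" by (auto simp: refl_on_def asymptotic_def)
  show "sym ?A" by (auto simp: sym_def asymptotic_def dist_commute)
  show "trans ?A"
  proof (rule transI)
    fix x y z :: "real \<Rightarrow> 'a"
    assume "(x, y) \<in> asymptotic" "(y, z) \<in> asymptotic"
    then obtain C D where *: "is_ray x" "is_ray z"
        "\<And>t. t \<ge> 0 \<Longrightarrow> dist (x t) (y t) \<le> C" "\<And>t. t \<ge> 0 \<Longrightarrow> dist (y t) (z t) \<le> D"
      by (auto simp: asymptotic_def)
    then have "dist (x t) (z t) \<le> C + D" if "t \<ge> 0" for t
      using that *(3,4)[of t] dist_triangle[of "x t" "z t" "y t"] by linarith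
    then show "(x, z) \<in> asymptotic" using * by (auto simp: asymptotic_def)
  qed
qed

section \<open>Limits of segments, and asymptotic rays\<close>

text \<open>Shared by the construction of asymptotic rays and of the limit of the projections. The
  hypothesis says roughly that the angles between the segments at \<open>p\<close> tend to zero. It
  gives locally uniform convergence and, at the endpoints, that \<open>f s\<close> strays only
  sublinearly from the limit ray.\<close>

lemma segments_limit:
  fixes f :: "real \<Rightarrow> 'a::hadamard_space"
  assumes far: "filterlim (\<lambda>t. dist p (f t)) at_top at_top"
    and cauchy: "\<And>e. 0 < e \<Longrightarrow> \<exists>N. \<forall>s t u. N \<le> s \<and> s \<le> t \<and> 0 \<le> u \<and> u \<le> dist p (f s) \<and>
      u \<le> dist p (f t) \<longrightarrow> dist (seg p (f s) u) (seg p (f t) u) \<le> e * u"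
  obtains x where "is_ray x" "x 0 = p"
    and "\<And>T. 0 \<le> T \<Longrightarrow> uniform_limit {0..T} (\<lambda>t. seg p (f t)) x at_top"
    and "\<And>e. 0 < e \<Longrightarrow> \<forall>\<^sub>F s in at_top. dist (f s) (x (dist p (f s))) \<le> e * dist p (f s)"
proof -
  have farn: "\<forall>\<^sub>F n in sequentially. u \<le> dist p (f (real n))" for u
    using filterlim_compose[OF far filterlim_real_sequentially] by (simp add: filterlim_at_top)
  have "Cauchy (\<lambda>n. seg p (f (real n)) u)" if u: "0 \<le> u" for u
    unfolding Cauchy_altdef2
  proof (intro allI impI)
    fix e :: real assume e: "e > 0"
    \<comment> \<open>The denominator \<open>u + 1\<close> makes \<open>e / (u + 1) * u\<close>
      strictly less than \<open>e\<close>, also for \<open>u = 0\<close>.\<close>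
    then have "0 < e / (u + 1)" using u by simp
    from cauchy[OF this] obtain N where N: "\<forall>s t u'. N \<le> s \<and> s \<le> t \<and> 0 \<le> u' \<and> u' \<le> dist p (f s) \<and>
      u' \<le> dist p (f t) \<longrightarrow> dist (seg p (f s) u') (seg p (f t) u') \<le> e / (u + 1) * u'" by blast
    obtain M where M: "\<And>n. n \<ge> M \<Longrightarrow> u \<le> dist p (f (real n))"
      using farn[of u] by (auto simp: eventually_sequentially)
    define K where "K = max M (nat \<lceil>N\<rceil>)"
    have "e / (u + 1) * u < e" using e u by (simp add: field_simps)
    moreover have "dist (seg p (f (real K)) u) (seg p (f (real n)) u) \<le> e / (u + 1) * u" if "n \<ge> K" for n
      using N[rule_format, of "real K" "real n" u] M[of n] M[of K] u that unfolding K_def by linarith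
    ultimately show "\<exists>N. \<forall>n\<ge>N. dist (seg p (f (real n)) u) (seg p (f (real N)) u) < e"
      by (intro exI[of _ K]) (auto simp: dist_commute intro: le_less_trans)
  qed
  then have "\<exists>y. (\<lambda>n. seg p (f (real n)) u) \<longlonglongrightarrow> y" if "0 \<le> u" for u
    using that Cauchy_convergent convergent_def by blast
  then obtain x where x: "\<And>u. 0 \<le> u \<Longrightarrow> (\<lambda>n. seg p (f (real n)) u) \<longlonglongrightarrow> x u"
    by metis
  \<comment> \<open>Here \<open>t\<close> runs to infinity through the integers while
    \<open>s\<close> stays an arbitrary real number, so the limit along integers controls the whole
    family.\<close>
  have est: "\<exists>N. \<forall>s u. N \<le> s \<and> 0 \<le> u \<and> u \<le> dist p (f s) \<longrightarrow> dist (seg p (f s) u) (x u) \<le> e * u"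
    if e: "0 < e" for e
  proof -
    from cauchy[OF that] obtain N where N: "\<forall>s t u'. N \<le> s \<and> s \<le> t \<and> 0 \<le> u' \<and> u' \<le> dist p (f s) \<and>
      u' \<le> dist p (f t) \<longrightarrow> dist (seg p (f s) u') (seg p (f t) u') \<le> e * u'" by blast
    have "dist (seg p (f s) u) (x u) \<le> e * u" if s: "N \<le> s" "0 \<le> u" "u \<le> dist p (f s)" for s u
    proof (rule tendsto_upperbound)
      show "(\<lambda>n. dist (seg p (f s) u) (seg p (f (real n)) u)) \<longlonglongrightarrow> dist (seg p (f s) u) (x u)"
        by (intro tendsto_intros x s)
      show "\<forall>\<^sub>F n in sequentially. dist (seg p (f s) u) (seg p (f (real n)) u) \<le> e * u"
        using farn[of u] eventually_ge_at_top[of "nat \<lceil>s\<rceil>"]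
      proof eventually_elim
        case (elim n)
        have "s \<le> real n" using elim(2) by linarith
        then show ?case using N s elim(1) by blast
      qed
    qed simp
    then show ?thesis by blast
  qed
  have ray: "is_ray x"
    unfolding is_ray_def
  proof (intro allI impI)
    fix s t :: real assume st: "0 \<le> s" "0 \<le> t"
    have "(\<lambda>n. dist (seg p (f (real n)) s) (seg p (f (real n)) t)) \<longlonglongrightarrow> dist (x s) (x t)"
      by (intro tendsto_intros x st)
    moreover have "\<forall>\<^sub>F n in sequentially. dist (seg p (f (real n)) s) (seg p (f (real n)) t) = \<bar>s - t\<bar>"
      using farn[of s] farn[of t]
    proof eventually_elim
      case (elim n)
      then show ?case using segment_between_seg[of p "f (real n)"] st by (auto simp: segment_between_def)
    qed
    then have "(\<lambda>n. dist (seg p (f (real n)) s) (seg p (f (real n)) t)) \<longlonglongrightarrow> \<bar>s - t\<bar>"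
      by (rule tendsto_eventually)
    ultimately show "dist (x s) (x t) = \<bar>s - t\<bar>" by (rule LIMSEQ_unique)
  qed
  have x0: "x 0 = p"
  proof -
    have "(\<lambda>n. p) \<longlonglongrightarrow> x 0" using x[of 0] by (simp add: seg_endpoints)
    then show ?thesis by (simp add: LIMSEQ_const_iff)
  qed
  have unif: "uniform_limit {0..T} (\<lambda>t. seg p (f t)) x at_top" if T: "0 \<le> T" for T
  proof (rule uniform_limitI)
    fix e :: real assume e: "0 < e"
    then have "0 < e / (T + 1)" using T by simp
    from est[OF this] obtain N where N: "\<And>s u. N \<le> s \<Longrightarrow> 0 \<le> u \<Longrightarrow> u \<le> dist p (f s) \<Longrightarrow>
      dist (seg p (f s) u) (x u) \<le> e / (T + 1) * u" by blast
    have "\<forall>\<^sub>F t in at_top. T \<le> dist p (f t)" using far by (simp add: filterlim_at_top)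
    then show "\<forall>\<^sub>F t in at_top. \<forall>u\<in>{0..T}. dist (seg p (f t) u) (x u) < e"
      using eventually_ge_at_top[of N]
    proof eventually_elim
      case (elim t)
      show ?case
      proof
        fix u assume u: "u \<in> {0..T}"
        have "e / (T + 1) * u \<le> e / (T + 1) * T" using e T u by (intro mult_left_mono) auto
        also have "\<dots> < e" using e T by (simp add: field_simps)
        finally show "dist (seg p (f t) u) (x u) < e" using N[of t u] elim u by auto
      qed
    qed
  qed
  have "\<forall>\<^sub>F s in at_top. dist (f s) (x (dist p (f s))) \<le> e * dist p (f s)" if e: "0 < e" for e
  proof -
    obtain N where N: "\<And>s u. N \<le> s \<Longrightarrow> 0 \<le> u \<Longrightarrow> u \<le> dist p (f s) \<Longrightarrow> dist (seg p (f s) u) (x u) \<le> e * u"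
      using est[OF e] by blast
    \<comment> \<open>At the largest admissible parameter the segment has reached \<open>f s\<close>
      itself.\<close>
    have "dist (f s) (x (dist p (f s))) \<le> e * dist p (f s)" if "N \<le> s" for s
      using N[OF that, of "dist p (f s)"] by (simp add: seg_endpoints)
    then show ?thesis unfolding eventually_at_top_linorder by blast
  qed
  then show ?thesis using that ray x0 unif by blast
qed

lemma uniform_limit_segments_tendsto:
  assumes "\<And>T. 0 \<le> T \<Longrightarrow> uniform_limit {0..T} (\<lambda>t. seg p (f t)) x at_top" "0 \<le> u"
  shows "((\<lambda>t. seg p (f t) u) \<longlongrightarrow> x u) at_top"
  using assms by (intro tendsto_uniform_limitI[OF assms(1)[of u]]) auto

lemma limit_ray_in_set:
  fixes f :: "real \<Rightarrow> 'a::hadamard_space"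
  assumes X: "closed X" "geodesically_convex X" "p \<in> X" "\<And>t. 0 \<le> t \<Longrightarrow> f t \<in> X"
    and far: "filterlim (\<lambda>t. dist p (f t)) at_top at_top"
    and lim: "\<And>T. 0 \<le> T \<Longrightarrow> uniform_limit {0..T} (\<lambda>t. seg p (f t)) x at_top" and u: "0 \<le> u"
  shows "x u \<in> X"
proof (rule Lim_in_closed_set[OF X(1) _ _ uniform_limit_segments_tendsto[OF lim u]])
  have "\<forall>\<^sub>F t in at_top. u \<le> dist p (f t)" using far by (simp add: filterlim_at_top)
  then show "\<forall>\<^sub>F t in at_top. seg p (f t) u \<in> X"
    using eventually_ge_at_top[of 0]
  proof eventually_elim
    case (elim t)
    then show ?case
      using geodesically_convex_segment[OF X(2,3) X(4) segment_between_seg u] by blast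
  qed
qed auto

text \<open>Monotonicity of the comparison angle at \<open>p\<close> when both sides are cut to
  length \<open>u\<close>, with denominators cleared. The difference of squares on the right
  vanishes for degenerate triangles and is easy to estimate.\<close>

lemma segments_comparison:
  fixes p :: "'a::hadamard_space"
  assumes u: "0 \<le> u" "u \<le> dist p x" "u \<le> dist p y" and pos: "0 < dist p x" "0 < dist p y"
  shows "dist p x * dist p y * (dist (seg p x u) (seg p y u))\<^sup>2
    \<le> u\<^sup>2 * ((dist x y)\<^sup>2 - (dist p x - dist p y)\<^sup>2)"
proof -
  define a b where "a = dist p x" and "b = dist p y"
  note ab = a_def[symmetric] b_def[symmetric]
  have pos': "0 < a" "0 < b" using pos by (auto simp: a_def b_def)
  have "(u / a) * (u / b) * comparison_inner p x y
    \<le> comparison_inner p (seg p x (u / a * a)) (seg p y (u / b * b))"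
    unfolding a_def b_def
    using u pos by (intro comparison_inner_segments segment_between_seg) auto
  then have "(u / a) * (u / b) * comparison_inner p x y \<le> comparison_inner p (seg p x u) (seg p y u)"
    using pos' by simp
  then have q: "u\<^sup>2 * comparison_inner p x y \<le> a * b * comparison_inner p (seg p x u) (seg p y u)"
    using pos' by (simp add: field_simps power2_eq_square)
  have d: "dist p (seg p x u) = u" "dist p (seg p y u) = u"
    using u segment_between_dist(1)[OF segment_between_seg] by auto
  have A: "(dist (seg p x u) (seg p y u))\<^sup>2 = 2 * u\<^sup>2 - 2 * comparison_inner p (seg p x u) (seg p y u)"
    using dist_sq_comparison_inner[of "seg p x u" "seg p y u" p] d by simp
  have B: "(dist x y)\<^sup>2 - (a - b)\<^sup>2 = 2 * a * b - 2 * comparison_inner p x y"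
    using dist_sq_comparison_inner[of x y p] by (simp add: ab power2_diff)
  show ?thesis using q unfolding ab A B right_diff_distrib by (simp add: mult_ac)
qed

lemma ray_dist_bounds:
  assumes "is_ray r" "0 \<le> t"
  shows "\<bar>dist p (r t) - t\<bar> \<le> dist p (r 0)"
proof -
  have "dist (r 0) (r t) = t" using is_ray_dist[of r 0 t] assms by simp
  then show ?thesis
    using dist_triangle[of p "r t" "r 0"] dist_triangle[of "r 0" "r t" p] dist_commute[of "r 0" p]
    by linarith
qed

lemma filterlim_dist_ray:
  assumes "is_ray r"
  shows "filterlim (\<lambda>t. dist p (r t)) at_top at_top"
proof (rule filterlim_at_top_mono)
  show "filterlim (\<lambda>t. t - dist p (r 0)) at_top at_top" by real_asymp
  show "\<forall>\<^sub>F t in at_top. t - dist p (r 0) \<le> dist p (r t)"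
    using eventually_ge_at_top[of 0]
  proof eventually_elim
    case (elim t)
    then show ?case using ray_dist_bounds[OF assms, of t p] by linarith
  qed
qed

text \<open>The ray is the limit of the segments from \<open>p\<close> to \<open>r t\<close>. Two
  far points of \<open>r\<close> are seen from \<open>p\<close> under a small angle, because the
  excess in the triangle inequality stays bounded while the sides grow.\<close>

lemma ex_asymptotic_ray:
  fixes p :: "'a::hadamard_space"
  assumes r: "is_ray r"
  obtains x where "(r, x) \<in> asymptotic" "x 0 = p"
    "\<And>T. 0 \<le> T \<Longrightarrow> uniform_limit {0..T} (\<lambda>t. seg p (r t)) x at_top"
proof -
  define D where "D = dist p (r 0)"
  have D: "\<bar>dist p (r t) - t\<bar> \<le> D" if "0 \<le> t" for t
    using ray_dist_bounds[OF r that] by (simp add: D_def)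
  have D0: "0 \<le> D" by (simp add: D_def)
  obtain x where x: "is_ray x" "x 0 = p"
    "\<And>T. 0 \<le> T \<Longrightarrow> uniform_limit {0..T} (\<lambda>t. seg p (r t)) x at_top"
  proof (rule segments_limit[of p r])
    show "filterlim (\<lambda>t. dist p (r t)) at_top at_top" by (rule filterlim_dist_ray[OF r])
    fix e :: real assume e: "0 < e"
    \<comment> \<open>The terms \<open>2 * D + 1\<close> keep the lengths \<open>a\<close> and
      \<open>b\<close> positive and \<open>b\<close> at least half of \<open>t\<close>; the last
      term lets \<open>e\<^sup>2 * a\<close> absorb \<open>8 * D\<close>.\<close>
    define N where "N = 2 * D + 1 + 8 * D / e\<^sup>2"
    have N: "2 * D + 1 \<le> N" "D + 8 * D / e\<^sup>2 \<le> N" using D0 e by (auto simp: N_def)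
    have "dist (seg p (r s) u) (seg p (r t) u) \<le> e * u"
      if *: "N \<le> s" "s \<le> t" "0 \<le> u" "u \<le> dist p (r s)" "u \<le> dist p (r t)" for s t u
    proof -
      define a b where "a = dist p (r s)" and "b = dist p (r t)"
      have st: "0 \<le> s" "0 \<le> t" using N D0 * by linarith+
      have a: "\<bar>a - s\<bar> \<le> D" and b: "\<bar>b - t\<bar> \<le> D" using D st by (auto simp: a_def b_def)
      have ab0: "0 < a" "0 < b" "t \<le> 2 * b" "8 * D / e\<^sup>2 \<le> a" using a b N D0 * by linarith+
      have dst: "dist (r s) (r t) = t - s" using is_ray_dist[OF r st] * by simp
      have "b - a \<le> t - s" "a - b \<le> t - s"
        using dist_triangle[of p "r t" "r s"] dist_triangle[of p "r s" "r t"] dst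
        by (auto simp: a_def b_def dist_commute)
      \<comment> \<open>A factored difference of squares: the first factor is bounded because
        \<open>a\<close> and \<open>b\<close> differ from \<open>s\<close> and \<open>t\<close> by
        at most \<open>D\<close>, and the second grows only like \<open>t\<close>.\<close>
      then have "(t - s - (b - a)) * (t - s + (b - a)) \<le> (2 * D) * (2 * t)"
        using a b st D0 by (intro mult_mono) linarith+
      moreover have "4 * D * t \<le> 8 * D * b" using ab0 D0 mult_left_mono[of t "2 * b" "4 * D"] by simp
      ultimately have 1: "(dist (r s) (r t))\<^sup>2 - (a - b)\<^sup>2 \<le> 8 * D * b"
        by (simp add: dst power2_eq_square algebra_simps)
      have "8 * D \<le> e\<^sup>2 * a" using ab0(4) e by (simp add: pos_divide_le_eq mult.commute)
      then have "8 * D * b \<le> e\<^sup>2 * a * b" using ab0 by (intro mult_right_mono) auto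
      have "a * b * (dist (seg p (r s) u) (seg p (r t) u))\<^sup>2
        \<le> u\<^sup>2 * ((dist (r s) (r t))\<^sup>2 - (a - b)\<^sup>2)"
        using segments_comparison[of u p "r s" "r t"] * ab0 unfolding a_def b_def by blast
      also have "\<dots> \<le> u\<^sup>2 * (e\<^sup>2 * a * b)"
        using 1 \<open>8 * D * b \<le> e\<^sup>2 * a * b\<close> by (intro mult_left_mono) auto
      also have "\<dots> = a * b * (e * u)\<^sup>2" by (simp add: power_mult_distrib)
      finally have "(dist (seg p (r s) u) (seg p (r t) u))\<^sup>2 \<le> (e * u)\<^sup>2"
        using ab0(1,2) by (simp only: mult_le_cancel_left_pos mult_pos_pos)
      then show ?thesis by (rule power2_le_imp_le) (use e * in simp)
    qed
    then show "\<exists>N. \<forall>s t u. N \<le> s \<and> s \<le> t \<and> 0 \<le> u \<and> u \<le> dist p (r s) \<and>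
      u \<le> dist p (r t) \<longrightarrow> dist (seg p (r s) u) (seg p (r t) u) \<le> e * u" by blast
  qed blast
  have "dist (r u) (x u) \<le> 2 * D" if u: "0 \<le> u" for u
  proof (rule tendsto_upperbound)
    show "((\<lambda>t. dist (r u) (seg p (r t) u)) \<longlongrightarrow> dist (r u) (x u)) at_top"
      by (intro tendsto_intros uniform_limit_segments_tendsto[OF x(3) u])
    show "\<forall>\<^sub>F t in at_top. dist (r u) (seg p (r t) u) \<le> 2 * D"
      using eventually_gt_at_top[of "u + D"]
    proof eventually_elim
      case (elim t)
      define a where "a = dist p (r t)"
      have t: "0 < t" "u \<le> t" using elim u D0 by linarith+
      have a: "\<bar>a - t\<bar> \<le> D" "u \<le> a" using D[of t] t elim by (auto simp: a_def)
      have rt: "dist (r t) (r 0) = t" "dist (r 0) (r t) = t"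
        using is_ray_dist[of r t 0] r t by (auto simp: dist_commute)
      \<comment> \<open>The triangle with vertices \<open>r t\<close>, \<open>r 0\<close> and
        \<open>p\<close> is shrunk from \<open>r t\<close>. This compares \<open>r u\<close> with
        the point of the segment at parameter \<open>u * a / t\<close>; correcting that parameter to
        \<open>u\<close> costs a second \<open>D\<close>.\<close>
      have "dist (r (t - (1 - u / t) * t)) (seg p (r t) (a - (1 - u / t) * a)) \<le> (1 - u / t) * D"
        using thales[OF segment_between_reverse[OF is_ray_segment[OF r]]
          segment_between_reverse[OF segment_between_seg], of t "1 - u / t" p] t u rt
        by (simp add: a_def D_def dist_commute)
      also have "\<dots> \<le> D" using D0 t u by (simp add: mult_left_le_one_le)
      also have "t - (1 - u / t) * t = u" using t by (simp add: field_simps)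
      also have "a - (1 - u / t) * a = u * a / t" using t by (simp add: field_simps)
      finally have 1: "dist (r u) (seg p (r t) (u * a / t)) \<le> D" .
      have "u * a / t \<le> a" 
        using t mult_right_mono[of u t a] by (simp add: a_def divide_le_eq mult.commute)
      then have "dist (seg p (r t) (u * a / t)) (seg p (r t) u) = \<bar>u * a / t - u\<bar>"
        using segment_between_seg[of p "r t"] t u a by (simp add: segment_between_def a_def)
      also have "u * a / t - u = u / t * (a - t)" using t by (simp add: field_simps)
      also have "\<bar>u / t * (a - t)\<bar> \<le> \<bar>a - t\<bar>"
        unfolding abs_mult using t u by (intro mult_left_le_one_le) auto
      finally show ?case
        using 1 a dist_triangle[of "r u" "seg p (r t) u" "seg p (r t) (u * a / t)"] by linarith
    qed
  qed simp
  then have "(r, x) \<in> asymptotic" using r x by (auto simp: asymptotic_def)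
  then show ?thesis using that x by blast
qed

section \<open>Boundary points\<close>

lemma ideal_boundaryE:
  assumes "\<eta> \<in> ideal_boundary S"
  obtains r where "is_ray r" "\<And>t. 0 \<le> t \<Longrightarrow> r t \<in> S" "\<eta> = asymptotic `` {r}"
  using assms unfolding ideal_boundary_def by (auto elim!: quotientE)

lemma ideal_boundary_asymptotic:
  assumes "\<eta> \<in> ideal_boundary S" "r \<in> \<eta>"
  shows "r' \<in> \<eta> \<longleftrightarrow> (r, r') \<in> asymptotic"
proof -
  obtain r0 where \<eta>: "\<eta> = asymptotic `` {r0}" using assms(1) by (rule ideal_boundaryE)
  have "sym asymptotic" "trans asymptotic" using equiv_asymptotic by (auto elim: equivE)
  moreover have "(r0, r) \<in> asymptotic" "r' \<in> \<eta> \<longleftrightarrow> (r0, r') \<in> asymptotic" using assms(2) \<eta> by auto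
  ultimately show ?thesis by (meson symD transD)
qed

text \<open>The existence of asymptotic rays from every point justifies the choice in
  \<open>ray_from\<close>.\<close>

lemma ray_from:
  assumes "\<eta> \<in> ideal_boundary S"
  shows "ray_from p \<eta> \<in> \<eta>" "ray_from p \<eta> 0 = p" "is_ray (ray_from p \<eta>)"
proof -
  obtain r where r: "is_ray r" "\<eta> = asymptotic `` {r}" using assms by (rule ideal_boundaryE)
  obtain x where "(r, x) \<in> asymptotic" "x 0 = p" using ex_asymptotic_ray[OF r(1), of p] by metis
  then have "x \<in> \<eta> \<and> x 0 = p" using r by simp
  then have "ray_from p \<eta> \<in> \<eta> \<and> ray_from p \<eta> 0 = p" 
    unfolding ray_from_def by (rule someI[of "\<lambda>r. r \<in> \<eta> \<and> r 0 = p"])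
  then show "ray_from p \<eta> \<in> \<eta>" "ray_from p \<eta> 0 = p" "is_ray (ray_from p \<eta>)"
    using r by (auto simp: asymptotic_def)
qed

lemma ray_from_eq:
  assumes "\<eta> \<in> ideal_boundary S" "r \<in> \<eta>" "0 \<le> t"
  shows "ray_from (r 0) \<eta> t = r t"
  using assms ray_from[OF assms(1), of "r 0"] ideal_boundary_asymptotic[OF assms(1)]
    asymptotic_same_origin by metis

lemma ray_from_uniform_limit:
  assumes \<eta>: "\<eta> \<in> ideal_boundary S" and r: "r \<in> \<eta>" and T: "0 \<le> T"
  shows "uniform_limit {0..T} (\<lambda>t. seg p (r t)) (ray_from p \<eta>) at_top"
proof -
  have "is_ray r" using ideal_boundary_asymptotic[OF \<eta> r] r by (auto simp: asymptotic_def)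
  then obtain x where x: "(r, x) \<in> asymptotic" "x 0 = p"
    "\<And>T. 0 \<le> T \<Longrightarrow> uniform_limit {0..T} (\<lambda>t. seg p (r t)) x at_top"
    using ex_asymptotic_ray[of r p] by metis
  have "x \<in> \<eta>" using x(1) ideal_boundary_asymptotic[OF \<eta> r] by blast
  then have "ray_from p \<eta> t = x t" if "t \<in> {0..T}" for t
    using ray_from_eq[OF \<eta>] x(2) that by auto
  then show ?thesis
    using x(3)[OF T] by (subst uniform_limit_cong'[of "{0..T}" _ "\<lambda>t. seg p (r t)" _ x]) auto
qed

text \<open>The ray from \<open>p\<close> is a limit of segments from \<open>p\<close> to points of
  some ray in \<open>X\<close>, and convexity keeps these segments in \<open>X\<close>. So the base
  point of a ray in \<open>X\<close> may be moved freely within \<open>X\<close>.\<close>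

lemma ray_from_in_set:
  assumes X: "closed X" "geodesically_convex X" "p \<in> X" and \<xi>: "\<xi> \<in> ideal_boundary X"
    and "0 \<le> t"
  shows "ray_from p \<xi> t \<in> X"
proof -
  obtain r where r: "is_ray r" "\<And>t. 0 \<le> t \<Longrightarrow> r t \<in> X" "\<xi> = asymptotic `` {r}"
    using \<xi> by (rule ideal_boundaryE) blast
  then have "r \<in> \<xi>" using equiv_class_self[OF equiv_asymptotic] by auto
  then show ?thesis
    using limit_ray_in_set[OF X r(2) filterlim_dist_ray[OF r(1)]
      ray_from_uniform_limit[OF \<xi>]] \<open>0 \<le> t\<close> by blast
qed

lemma ideal_boundary_eqI:
  assumes "\<eta> \<in> ideal_boundary S" "\<xi> \<in> ideal_boundary S'"
    and "\<And>t. 0 \<le> t \<Longrightarrow> ray_from p \<eta> t = ray_from p \<xi> t"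
  shows "\<eta> = \<xi>"
proof -
  have "(ray_from p \<eta>, ray_from p \<xi>) \<in> asymptotic"
    using ray_from(3)[OF assms(1), of p] ray_from(3)[OF assms(2), of p] assms(3)
    by (auto simp: asymptotic_def intro!: exI[of _ 0])
  then have "ray_from p \<xi> \<in> \<eta>"
    using ideal_boundary_asymptotic[OF assms(1) ray_from(1)[OF assms(1)]] by blast
  then show ?thesis
    using ideal_boundary_asymptotic[OF assms(1)] 
      ideal_boundary_asymptotic[OF assms(2) ray_from(1)[OF assms(2), of p]] by blast
qed

section \<open>The Tits angle\<close>

text \<open>For unit speed rays with a common origin this is the cosine of the comparison angle.\<close>

definition ray_cos :: "(real \<Rightarrow> 'a::metric_space) \<Rightarrow> (real \<Rightarrow> 'a) \<Rightarrow> real \<Rightarrow> real \<Rightarrow> real" where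
  "ray_cos r r' s t = comparison_inner (r 0) (r s) (r' t) / (s * t)"

lemma ray_origin_dist: "is_ray r \<Longrightarrow> 0 \<le> t \<Longrightarrow> dist (r 0) (r t) = t"
  using is_ray_dist[of r 0 t] by simp

text \<open>The rays are cut at the fractions \<open>s / s'\<close> and \<open>t / t'\<close>, and
  these factors in the scaling law are absorbed by the denominators of the cosines.\<close>

lemma ray_cos_antimono:
  assumes r: "is_ray r" "is_ray r'" "r 0 = r' 0"
    and st: "0 < s" "s \<le> s'" "0 < t" "t \<le> t'"
  shows "ray_cos r r' s' t' \<le> ray_cos r r' s t"
proof -
  have "segment_between (r 0) (r s') r" "segment_between (r 0) (r' t') r'"
    using is_ray_segment[of r s'] is_ray_segment[of r' t'] r st by auto
  moreover have "dist (r 0) (r s') = s'" "dist (r 0) (r' t') = t'"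
    using ray_origin_dist[of r s'] ray_origin_dist[of r' t'] r st by auto
  ultimately have "(s / s') * (t / t') * comparison_inner (r 0) (r s') (r' t')
      \<le> comparison_inner (r 0) (r s) (r' t)"
    using comparison_inner_segments[of "r 0" "r s'" r "r' t'" r' "s / s'" "t / t'"] st by simp
  then show ?thesis using st by (simp add: ray_cos_def field_simps)
qed

lemma abs_ray_cos_le_1:
  assumes r: "is_ray r" "is_ray r'" "r 0 = r' 0" and st: "0 < s" "0 < t"
  shows "\<bar>ray_cos r r' s t\<bar> \<le> 1"
proof -
  have "dist (r 0) (r s) = s" "dist (r 0) (r' t) = t"
    using ray_origin_dist[of r s] ray_origin_dist[of r' t] r st by auto
  then show ?thesis
    using abs_comparison_inner_le[of "r 0" "r s" "r' t"] st by (simp add: ray_cos_def abs_mult)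
qed

lemma comparison_angle_ray_cos:
  assumes r: "is_ray r" "is_ray r'" "r 0 = r' 0" and st: "0 < s" "0 < t"
  shows "comparison_angle (r 0) (r s) (r' t) = arccos (ray_cos r r' s t)"
proof -
  have "dist (r 0) (r s) = s" "dist (r 0) (r' t) = t"
    using ray_origin_dist[of r s] ray_origin_dist[of r' t] r st by auto
  then show ?thesis
    by (simp add: comparison_angle_def ray_cos_def comparison_inner_def mult.assoc)
qed

text \<open>By monotonicity in both variables the limit is the infimum. The resulting bound at
  finite parameters is recorded because the estimate of the distance to \<open>X\<close> rests on
  it.\<close>

lemma ray_cos_limit:
  assumes r: "is_ray r" "is_ray r'" "r 0 = r' 0"
  obtains L where "-1 \<le> L" "L \<le> 1" "\<And>s t. 0 < s \<Longrightarrow> 0 < t \<Longrightarrow> L \<le> ray_cos r r' s t"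
    "((\<lambda>(s, t). ray_cos r r' s t) \<longlongrightarrow> L) (at_top \<times>\<^sub>F at_top)"
proof -
  define A where "A = (\<lambda>(s, t). ray_cos r r' s t) ` ({0<..} \<times> {0<..})"
  define L where "L = Inf A"
  have A: "\<bar>a\<bar> \<le> 1" if "a \<in> A" for a
    using that abs_ray_cos_le_1[OF r] by (auto simp: A_def)
  have bdd: "bdd_below A" using A by (intro bdd_belowI[of _ "-1"]) (auto simp: abs_le_iff)
  have ne: "A \<noteq> {}" by (simp add: A_def)
  have lower: "L \<le> ray_cos r r' s t" if "0 < s" "0 < t" for s t
    unfolding L_def using bdd that by (intro cInf_lower) (auto simp: A_def)
  have "-1 \<le> L" unfolding L_def using ne A by (intro cInf_greatest) (auto simp: abs_le_iff)
  moreover have "L \<le> 1" using lower[of 1 1] abs_ray_cos_le_1[OF r, of 1 1] by simp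
  moreover have "((\<lambda>(s, t). ray_cos r r' s t) \<longlongrightarrow> L) (at_top \<times>\<^sub>F at_top)"
  proof (rule order_tendstoI)
    fix a assume "a < L"
    then have "a < ray_cos r r' s t" if "0 < s" "0 < t" for s t using lower[OF that] by simp
    then show "\<forall>\<^sub>F x in at_top \<times>\<^sub>F at_top. a < (case x of (s, t) \<Rightarrow> ray_cos r r' s t)"
      unfolding eventually_prod_same
      by (intro exI[of _ "\<lambda>t. 0 < t"] conjI eventually_gt_at_top) auto
  next
    fix a assume "L < a"
    then obtain b where "b \<in> A" "b < a" using cInf_lessD[OF ne] unfolding L_def by blast
    then obtain s t where st: "0 < s" "0 < t" "ray_cos r r' s t < a" by (auto simp: A_def)
    have "ray_cos r r' s' t' < a" if "s \<le> s'" "t \<le> t'" for s' t'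
      using ray_cos_antimono[OF r st(1) that(1) st(2) that(2)] st(3) by simp
    then show "\<forall>\<^sub>F x in at_top \<times>\<^sub>F at_top. (case x of (s, t) \<Rightarrow> ray_cos r r' s t) < a"
      unfolding eventually_prod_filter
      by (intro exI[of _ "\<lambda>x. s \<le> x"] exI[of _ "\<lambda>x. t \<le> x"] conjI eventually_ge_at_top) auto
  qed
  ultimately show ?thesis using that lower by blast
qed

lemma ray_cos_diagonal:
  assumes r: "is_ray r" "is_ray r'" "r 0 = r' 0" and t: "0 < t"
  shows "ray_cos r r' t t = 1 - (dist (r t) (r' t))\<^sup>2 / (2 * t\<^sup>2)" "dist (r t) (r' t) \<le> 2 * t"
proof -
  have d: "dist (r 0) (r t) = t" "dist (r 0) (r' t) = t"
    using ray_origin_dist[of r t] ray_origin_dist[of r' t] r t by auto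
  then show "ray_cos r r' t t = 1 - (dist (r t) (r' t))\<^sup>2 / (2 * t\<^sup>2)"
    using t by (simp add: ray_cos_def comparison_inner_def field_simps power2_eq_square)
  show "dist (r t) (r' t) \<le> 2 * t"
    using dist_triangle3[of "r t" "r' t" "r 0"] d by simp
qed

text \<open>Both limits may be taken on the diagonal. There, passing to asymptotic rays changes the
  chord by a bounded amount and its square by \<open>O(t)\<close>, while the cosine divides that
  square by \<open>2 * t\<^sup>2\<close>.\<close>

lemma ray_cos_limit_unique:
  assumes r: "is_ray r" "is_ray r'" "r 0 = r' 0" and q: "is_ray q" "is_ray q'" "q 0 = q' 0"
    and as: "(r, q) \<in> asymptotic" "(r', q') \<in> asymptotic"
    and L: "((\<lambda>(s, t). ray_cos r r' s t) \<longlongrightarrow> L) (at_top \<times>\<^sub>F at_top)"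
    and M: "((\<lambda>(s, t). ray_cos q q' s t) \<longlongrightarrow> M) (at_top \<times>\<^sub>F at_top)"
  shows "L = M"
proof -
  obtain C C' where C: "\<And>t. t \<ge> 0 \<Longrightarrow> dist (r t) (q t) \<le> C" "\<And>t. t \<ge> 0 \<Longrightarrow> dist (r' t) (q' t) \<le> C'"
    using as by (auto simp: asymptotic_def)
  have diag: "filterlim (\<lambda>t::real. (t, t)) (at_top \<times>\<^sub>F at_top) at_top"
    by (intro filterlim_Pair filterlim_ident)
  have "((\<lambda>t. ray_cos r r' t t - ray_cos q q' t t) \<longlongrightarrow> L - M) at_top"
    using filterlim_compose[OF L diag] filterlim_compose[OF M diag] by (intro tendsto_intros) auto
  moreover have "((\<lambda>t. ray_cos r r' t t - ray_cos q q' t t) \<longlongrightarrow> 0) at_top"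
  proof (rule Lim_null_comparison)
    show "((\<lambda>t. 2 * (C + C') / t) \<longlongrightarrow> 0) at_top" by real_asymp
    show "\<forall>\<^sub>F t in at_top. norm (ray_cos r r' t t - ray_cos q q' t t) \<le> 2 * (C + C') / t"
      using eventually_gt_at_top[of 0]
    proof eventually_elim
      case (elim t)
      define d e where "d = dist (r t) (r' t)" and "e = dist (q t) (q' t)"
      have t: "0 \<le> t" using elim by simp
      have de: "0 \<le> d" "d \<le> 2 * t" "0 \<le> e" "e \<le> 2 * t"
        using ray_cos_diagonal(2)[OF r elim] ray_cos_diagonal(2)[OF q elim] by (auto simp: d_def e_def)
      have "\<bar>d - e\<bar> \<le> C + C'"
        using C[OF t] dist_triangle[of "r t" "r' t" "q t"] dist_triangle[of "q t" "r' t" "q' t"]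
          dist_triangle[of "q t" "q' t" "r t"] dist_triangle[of "r t" "q' t" "r' t"]
        unfolding d_def e_def dist_commute[of "q' t" "r' t"] dist_commute[of "q t" "r t"] by linarith
      then have "\<bar>d - e\<bar> * (d + e) \<le> (C + C') * (4 * t)"
        using de by (intro mult_mono) auto
      moreover have "\<bar>d\<^sup>2 - e\<^sup>2\<bar> = \<bar>d - e\<bar> * (d + e)"
        using de by (simp add: power2_eq_square square_diff_square_factored abs_mult)
      ultimately have "\<bar>d\<^sup>2 - e\<^sup>2\<bar> / (2 * t\<^sup>2) \<le> (C + C') * (4 * t) / (2 * t\<^sup>2)"
        by (intro divide_right_mono) auto
      also have "\<dots> = 2 * (C + C') / t" using elim by (simp add: field_simps power2_eq_square)
      finally have "\<bar>d\<^sup>2 - e\<^sup>2\<bar> / (2 * t\<^sup>2) \<le> 2 * (C + C') / t" .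
      moreover have "ray_cos r r' t t - ray_cos q q' t t = (e\<^sup>2 - d\<^sup>2) / (2 * t\<^sup>2)"
        unfolding ray_cos_diagonal(1)[OF r elim] ray_cos_diagonal(1)[OF q elim] d_def e_def
        by (simp add: diff_divide_distrib)
      ultimately show ?case by (simp add: abs_divide abs_minus_commute)
    qed
  qed
  ultimately have "L - M = 0" by (rule tendsto_unique[rotated]) simp
  then show ?thesis by simp
qed

text \<open>Independence of the base point makes the definite description proper. Later arguments
  need only the cosine, as a limit and as a lower bound at finite parameters, and the range on which
  it determines the angle.\<close>

lemma tits_angle:
  assumes \<eta>: "\<eta> \<in> ideal_boundary S" and \<xi>: "\<xi> \<in> ideal_boundary S'"
  shows "0 \<le> tits_angle \<eta> \<xi>" "tits_angle \<eta> \<xi> \<le> pi"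
    and "\<And>p s t. 0 < s \<Longrightarrow> 0 < t \<Longrightarrow> cos (tits_angle \<eta> \<xi>) \<le> ray_cos (ray_from p \<eta>) (ray_from p \<xi>) s t"
    and "\<And>p. ((\<lambda>(s, t). ray_cos (ray_from p \<eta>) (ray_from p \<xi>) s t) \<longlongrightarrow> cos (tits_angle \<eta> \<xi>))
      (at_top \<times>\<^sub>F at_top)"
proof -
  have rays: "is_ray (ray_from p \<eta>)" "is_ray (ray_from p \<xi>)" "ray_from p \<eta> 0 = ray_from p \<xi> 0"
      "ray_from p \<eta> 0 = p" for p
    using ray_from[OF \<eta>, of p] ray_from[OF \<xi>, of p] by auto
  obtain p0 :: 'a where True by blast
  obtain L where L: "-1 \<le> L" "L \<le> 1"
    and L0: "((\<lambda>(s, t). ray_cos (ray_from p0 \<eta>) (ray_from p0 \<xi>) s t) \<longlongrightarrow> L) (at_top \<times>\<^sub>F at_top)"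
    using ray_cos_limit[OF rays(1-3)[of p0]] by metis
  \<comment> \<open>The limit found at \<open>p0\<close> is carried to every \<open>p\<close> along
    asymptotic rays.\<close>
  have *: "(\<forall>s>0. \<forall>t>0. L \<le> ray_cos (ray_from p \<eta>) (ray_from p \<xi>) s t) \<and>
    ((\<lambda>(s, t). ray_cos (ray_from p \<eta>) (ray_from p \<xi>) s t) \<longlongrightarrow> L) (at_top \<times>\<^sub>F at_top)" for p
  proof -
    obtain M where M: "\<And>s t. 0 < s \<Longrightarrow> 0 < t \<Longrightarrow> M \<le> ray_cos (ray_from p \<eta>) (ray_from p \<xi>) s t"
      "((\<lambda>(s, t). ray_cos (ray_from p \<eta>) (ray_from p \<xi>) s t) \<longlongrightarrow> M) (at_top \<times>\<^sub>F at_top)"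
      using ray_cos_limit[OF rays(1-3)[of p]] by metis
    have "(ray_from p0 \<eta>, ray_from p \<eta>) \<in> asymptotic" "(ray_from p0 \<xi>, ray_from p \<xi>) \<in> asymptotic"
      using ideal_boundary_asymptotic[OF \<eta>] ideal_boundary_asymptotic[OF \<xi>] ray_from(1)[OF \<eta>]
        ray_from(1)[OF \<xi>] by blast+
    then have "L = M" using ray_cos_limit_unique[OF rays(1-3)[of p0] rays(1-3)[of p] _ _ L0 M(2)] by blast
    then show ?thesis using M by simp
  qed
  have lim: "((\<lambda>(t, t'). comparison_angle p (ray_from p \<eta> t) (ray_from p \<xi> t')) \<longlongrightarrow> arccos L)
       (at_top \<times>\<^sub>F at_top)" for p
  proof (rule Lim_transform_eventually)
    show "((\<lambda>x. arccos (case x of (s, t) \<Rightarrow> ray_cos (ray_from p \<eta>) (ray_from p \<xi>) s t)) \<longlongrightarrow> arccos L)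
      (at_top \<times>\<^sub>F at_top)"
    proof (rule continuous_on_tendsto_compose[OF continuous_on_arccos'])
      show "((\<lambda>(s, t). ray_cos (ray_from p \<eta>) (ray_from p \<xi>) s t) \<longlongrightarrow> L) (at_top \<times>\<^sub>F at_top)"
        using * by blast
      show "\<forall>\<^sub>F x in at_top \<times>\<^sub>F at_top.
          (case x of (s, t) \<Rightarrow> ray_cos (ray_from p \<eta>) (ray_from p \<xi>) s t) \<in> {- 1..1}"
        using eventually_prodI[OF eventually_gt_at_top[of "0::real"] eventually_gt_at_top[of "0::real"]]
      proof eventually_elim
        case (elim x)
        then show ?case
          using abs_ray_cos_le_1[OF rays(1-3)[of p], of "fst x" "snd x"]
          by (auto simp: case_prod_unfold abs_le_iff)
      qed
    qed (use L in simp)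
    show "\<forall>\<^sub>F x in at_top \<times>\<^sub>F at_top. arccos (case x of (s, t) \<Rightarrow> ray_cos (ray_from p \<eta>) (ray_from p \<xi>) s t)
      = (case x of (t, t') \<Rightarrow> comparison_angle p (ray_from p \<eta> t) (ray_from p \<xi> t'))"
      using eventually_prodI[OF eventually_gt_at_top[of "0::real"] eventually_gt_at_top[of "0::real"]]
    proof eventually_elim
      case (elim x)
      then show ?case
        using comparison_angle_ray_cos[OF rays(1-3)[of p], of "fst x" "snd x"] rays(4)[of p]
        by (simp add: case_prod_unfold)
    qed
  qed
  have "tits_angle \<eta> \<xi> = arccos L"
    unfolding tits_angle_def
  proof (rule the_equality)
    fix a assume "\<forall>p. ((\<lambda>(t, t'). comparison_angle p (ray_from p \<eta> t) (ray_from p \<xi> t')) \<longlongrightarrow> a)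
       (at_top \<times>\<^sub>F at_top)"
    then show "a = arccos L"
      using lim tendsto_unique[of "at_top \<times>\<^sub>F at_top :: (real \<times> real) filter"]
      by (metis prod_filter_eq_bot trivial_limit_at_top_linorder)
  qed (use lim in blast)
  moreover from this have "cos (tits_angle \<eta> \<xi>) = L" using L by simp
  ultimately show "0 \<le> tits_angle \<eta> \<xi>" "tits_angle \<eta> \<xi> \<le> pi"
    "\<And>p s t. 0 < s \<Longrightarrow> 0 < t \<Longrightarrow> cos (tits_angle \<eta> \<xi>) \<le> ray_cos (ray_from p \<eta>) (ray_from p \<xi>) s t"
    "\<And>p. ((\<lambda>(s, t). ray_cos (ray_from p \<eta>) (ray_from p \<xi>) s t) \<longlongrightarrow> cos (tits_angle \<eta> \<xi>))
      (at_top \<times>\<^sub>F at_top)"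
    using * L by (simp_all add: arccos_lbound arccos_ubound)
qed

section \<open>Rays with bounded projection\<close>

lemma antimono_tendsto_at_top:
  fixes f :: "real \<Rightarrow> real"
  assumes mono: "\<And>s t. a < s \<Longrightarrow> s \<le> t \<Longrightarrow> f t \<le> f s" and lower: "\<And>t. a < t \<Longrightarrow> K \<le> f t"
  obtains L where "(f \<longlongrightarrow> L) at_top" "\<And>t. a < t \<Longrightarrow> L \<le> f t"
proof -
  define L where "L = Inf (f ` {a<..})"
  have bdd: "bdd_below (f ` {a<..})" using lower by (auto intro: bdd_belowI[of _ K])
  have L: "L \<le> f t" if "a < t" for t unfolding L_def using bdd that by (intro cInf_lower) auto
  have "(f \<longlongrightarrow> L) at_top"
  proof (rule order_tendstoI)
    fix b assume "b < L"
    show "\<forall>\<^sub>F t in at_top. b < f t"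
      using eventually_gt_at_top[of a] by (rule eventually_mono) (use L \<open>b < L\<close> less_le_trans in blast)
  next
    fix b assume "L < b"
    then obtain s where s: "a < s" "f s < b" using cInf_lessD[of "f ` {a<..}" b] by (auto simp: L_def)
    show "\<forall>\<^sub>F t in at_top. f t < b"
      using eventually_ge_at_top[of s] by (rule eventually_mono) (use mono[OF s(1)] s(2) le_less_trans in blast)
  qed
  then show ?thesis using that L by blast
qed

section \<open>Busemann functions\<close>

definition busemann :: "(real \<Rightarrow> 'a::metric_space) \<Rightarrow> 'a \<Rightarrow> real" where
  "busemann r x = Lim at_top (\<lambda>t. dist x (r t) - t)"

text \<open>By the triangle inequality \<open>dist x (r t) - t\<close> does not increase with
  \<open>t\<close>, so the limit is also the infimum.\<close>

lemma busemann:
  assumes r: "is_ray r"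
  shows "((\<lambda>t. dist x (r t) - t) \<longlongrightarrow> busemann r x) at_top"
    and "\<And>t. 0 < t \<Longrightarrow> busemann r x \<le> dist x (r t) - t"
    and "- dist x (r 0) \<le> busemann r x"
proof -
  have lower: "- dist x (r 0) \<le> dist x (r t) - t" if "0 < t" for t
    using ray_dist_bounds[OF r, of t x] that by linarith
  obtain L where L: "((\<lambda>t. dist x (r t) - t) \<longlongrightarrow> L) at_top" "\<And>t. 0 < t \<Longrightarrow> L \<le> dist x (r t) - t"
  proof (rule antimono_tendsto_at_top[of 0 "\<lambda>t. dist x (r t) - t" "- dist x (r 0)"])
    fix s t :: real assume st: "0 < s" "s \<le> t"
    then have "dist (r s) (r t) = t - s" using is_ray_dist[OF r, of s t] by simp
    then show "dist x (r t) - t \<le> dist x (r s) - s"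
      using dist_triangle[of x "r t" "r s"] by linarith
  qed (use lower in blast)+
  then have "busemann r x = L" unfolding busemann_def by (intro tendsto_Lim) auto
  then show "((\<lambda>t. dist x (r t) - t) \<longlongrightarrow> busemann r x) at_top"
    "\<And>t. 0 < t \<Longrightarrow> busemann r x \<le> dist x (r t) - t" using L by auto
  from this(1) show "- dist x (r 0) \<le> busemann r x"
  proof (rule tendsto_lowerbound)
    show "\<forall>\<^sub>F t in at_top. - dist x (r 0) \<le> dist x (r t) - t"
      by (rule eventually_mono[OF eventually_gt_at_top[of 0] lower])
  qed simp
qed

lemma busemann_lipschitz:
  assumes r: "is_ray r"
  shows "busemann r x - busemann r y \<le> dist x y"
proof (rule tendsto_upperbound)
  show "((\<lambda>t. (dist x (r t) - t) - (dist y (r t) - t)) \<longlongrightarrow> busemann r x - busemann r y) at_top"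
    by (intro tendsto_diff busemann r)
  have "(dist x (r t) - t) - (dist y (r t) - t) \<le> dist x y" for t
    using dist_triangle[of x "r t" y] by simp
  then show "\<forall>\<^sub>F t in at_top. (dist x (r t) - t) - (dist y (r t) - t) \<le> dist x y" by simp
qed simp

lemma continuous_on_busemann:
  assumes r: "is_ray r"
  shows "continuous_on S (busemann r)"
proof -
  have "dist (busemann r y) (busemann r x) \<le> dist y x" for x y
    using busemann_lipschitz[OF r, of x y] busemann_lipschitz[OF r, of y x]
    by (simp add: dist_real_def dist_commute abs_le_iff)
  then show ?thesis unfolding continuous_on_iff by (meson le_less_trans)
qed

lemma busemann_midpt_le:
  assumes r: "is_ray r"
  shows "busemann r (midpt x y) \<le> (busemann r x + busemann r y) / 2"
proof (rule tendsto_le)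
  show "((\<lambda>t. ((dist x (r t) - t) + (dist y (r t) - t)) / 2) \<longlongrightarrow> (busemann r x + busemann r y) / 2) at_top"
    by (intro tendsto_intros busemann r) simp
  show "((\<lambda>t. dist (midpt x y) (r t) - t) \<longlongrightarrow> busemann r (midpt x y)) at_top"
    by (intro busemann r)
  have "dist (midpt x y) (r t) - t \<le> ((dist x (r t) - t) + (dist y (r t) - t)) / 2" for t
    using midpt_le[of x y "r t"] by (simp add: field_simps)
  then show "\<forall>\<^sub>F t in at_top. dist (midpt x y) (r t) - t \<le> ((dist x (r t) - t) + (dist y (r t) - t)) / 2"
    by simp
qed simp

text \<open>Walking from \<open>p\<close> towards \<open>r t\<close> for a length \<open>u\<close>
  shortens the distance to \<open>r t\<close> by exactly \<open>u\<close>, and the ray from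
  \<open>p\<close> is the limit of these walks.\<close>

lemma busemann_ray_from_le:
  assumes \<eta>: "\<eta> \<in> ideal_boundary S" and r: "r \<in> \<eta>" and u: "0 \<le> u"
  shows "busemann r (ray_from p \<eta> u) \<le> busemann r p - u"
proof (rule tendsto_le)
  have ray: "is_ray r" using ideal_boundary_asymptotic[OF \<eta> r] r by (auto simp: asymptotic_def)
  let ?x = "ray_from p \<eta> u"
  show "((\<lambda>t. dist ?x (r t) - t) \<longlongrightarrow> busemann r ?x) at_top"
    by (rule busemann[OF ray])
  have "((\<lambda>t. seg p (r t) u) \<longlongrightarrow> ?x) at_top"
    by (rule uniform_limit_segments_tendsto[OF ray_from_uniform_limit[OF \<eta> r] u])
  then have "((\<lambda>t. dist ?x (seg p (r t) u) + (dist p (r t) - t) - u) \<longlongrightarrow>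
      dist ?x ?x + busemann r p - u) at_top"
    by (intro tendsto_intros busemann ray)
  then show "((\<lambda>t. dist ?x (seg p (r t) u) + (dist p (r t) - t) - u) \<longlongrightarrow> busemann r p - u) at_top"
    by simp
  have "\<forall>\<^sub>F t in at_top. u \<le> dist p (r t)"
    using filterlim_dist_ray[OF ray] by (simp add: filterlim_at_top)
  then show "\<forall>\<^sub>F t in at_top. dist ?x (r t) - t \<le> dist ?x (seg p (r t) u) + (dist p (r t) - t) - u"
  proof eventually_elim
    case (elim t)
    then show ?case
      using segment_between_dist(2)[OF segment_between_seg u elim]
        dist_triangle[of ?x "r t" "seg p (r t) u"] by linarith
  qed
qed simp

lemma bounded_projection_fixed_point:
  fixes X :: "'a::hadamard_space set"
  assumes X: "closed X" "geodesically_convex X" "x0 \<in> X" and \<eta>: "\<eta> \<in> ideal_boundary UNIV"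
    and bd: "bounded ((\<lambda>t. nearest_point X (ray_from x0 \<eta> t)) ` {0..})"
  shows "\<exists>p\<in>X. \<forall>t>0. nearest_point X (ray_from p \<eta> t) = p"
proof -
  define r where "r = ray_from x0 \<eta>"
  have r: "r \<in> \<eta>" "is_ray r" using ray_from[OF \<eta>] by (auto simp: r_def)
  have ne: "X \<noteq> {}" using X by blast
  \<comment> \<open>The closed ball of radius \<open>R\<close> about \<open>x0\<close> contains all
    projections and makes the domain of minimisation bounded.\<close>
  obtain R where R: "\<And>t. 0 \<le> t \<Longrightarrow> dist x0 (nearest_point X (r t)) \<le> R"
    using bd by (auto simp: bounded_any_center[of _ x0] r_def)
  have R0: "0 \<le> R" using R[of 0] zero_le_dist order_trans by blast
  obtain p where p: "p \<in> X \<inter> cball x0 R" "\<And>x. x \<in> X \<inter> cball x0 R \<Longrightarrow> busemann r p \<le> busemann r x"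
  proof (rule quasiconvex_attains_min[of "X \<inter> cball x0 R" "busemann r"])
    show "X \<inter> cball x0 R \<noteq> {}" using X R0 by auto
    show "midpt y z \<in> X \<inter> cball x0 R"
      if "y \<in> X \<inter> cball x0 R" "z \<in> X \<inter> cball x0 R" for y z
      using that geodesically_convex_midpt[OF X(2), of y z] midpt_le[of y z x0]
      by (auto simp: dist_commute)
    show "bdd_below (busemann r ` (X \<inter> cball x0 R))"
    proof (rule bdd_belowI2)
      fix x assume "x \<in> X \<inter> cball x0 R"
      moreover have "r 0 = x0" using ray_from[OF \<eta>] by (simp add: r_def)
      ultimately show "- R \<le> busemann r x" using busemann(3)[OF r(2), of x] by (simp add: dist_commute)
    qed
    show "busemann r (midpt x y) \<le> max (busemann r x) (busemann r y)" for x y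
      using busemann_midpt_le[OF r(2), of x y] by (auto simp: max_def field_simps)
  qed (use X in \<open>auto intro: continuous_on_busemann[OF r(2)] bounded_Int\<close>)
  \<comment> \<open>Minimality spreads from the ball to \<open>X\<close>: the projection of
    \<open>r t\<close> lies in the ball and is no farther from \<open>r t\<close> than
    \<open>x\<close>.\<close>
  have min: "busemann r p \<le> busemann r x" if x: "x \<in> X" for x
  proof (rule tendsto_lowerbound[OF busemann(1)[OF r(2)]])
    show "\<forall>\<^sub>F t in at_top. busemann r p \<le> dist x (r t) - t"
      using eventually_gt_at_top[of 0]
    proof eventually_elim
      case (elim t)
      have "nearest_point X (r t) \<in> X \<inter> cball x0 R"
        using nearest_point(1)[OF X(1,2) ne] R[of t] elim by simp
      from p(2)[OF this] show ?case
        using busemann(2)[OF r(2) elim, of "nearest_point X (r t)"]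
          nearest_point(2)[OF X(1,2) ne x, of "r t"] by (simp add: dist_commute)
    qed
  qed simp
  have "nearest_point X (ray_from p \<eta> t) = p" if t: "0 < t" for t
  proof (rule nearest_point_eqI[OF X(2)])
    fix z assume z: "z \<in> X"
    have "dist (ray_from p \<eta> t) p = t"
      using ray_origin_dist[OF ray_from(3)[OF \<eta>], of t p] ray_from(2)[OF \<eta>, of p] t
      by (simp add: dist_commute)
    \<comment> \<open>The Busemann function drops by at least \<open>t\<close> from \<open>p\<close>
      to the ray point, and its value at \<open>z\<close> is at least that at \<open>p\<close>. The
      Lipschitz bound makes \<open>z\<close> at least \<open>t\<close> away.\<close>
    then show "dist (ray_from p \<eta> t) p \<le> dist (ray_from p \<eta> t) z"
      using min[OF z] busemann_ray_from_le[OF \<eta> r(1), of t p]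
        busemann_lipschitz[OF r(2), of z "ray_from p \<eta> t"] t by (simp add: dist_commute)
  qed (use p in simp)
  then show ?thesis using p by blast
qed

section \<open>Rays at Tits distance less than a right angle\<close>

lemma segment_between_restrict:
  assumes "segment_between x y c" "0 \<le> b" "b \<le> dist x y"
  shows "segment_between x (c b) c"
  using assms segment_between_dist(1)[OF assms] by (simp add: segment_between_def)

text \<open>Convexity bounds the distance from the left point to \<open>r s\<close>, and then the projection
  inequality at \<open>r s\<close> applies.\<close>

lemma dist_seg_projection_le:
  fixes X :: "'a::hadamard_space set"
  assumes X: "closed X" "geodesically_convex X" "r 0 \<in> X" and r: "is_ray r" and st: "0 < s" "s \<le> t"
  shows "(dist (seg (r 0) (nearest_point X (r t)) (s / t * dist (r 0) (nearest_point X (r t))))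
      (nearest_point X (r s)))\<^sup>2
    \<le> (s / t * dist (r t) (nearest_point X (r t)))\<^sup>2 - (dist (r s) (nearest_point X (r s)))\<^sup>2"
proof -
  define P where "P t = nearest_point X (r t)" for t
  define y where "y = seg (r 0) (P t) (s / t * dist (r 0) (P t))"
  have ne: "X \<noteq> {}" using X by blast
  have PX: "P t \<in> X" for t using nearest_point(1)[OF X(1,2) ne] by (simp add: P_def)
  have l: "0 \<le> s / t" "s / t \<le> 1" "0 < t" using st by auto
  have "s / t * dist (r 0) (P t) \<le> dist (r 0) (P t)" using l by (intro mult_left_le_one_le) auto
  then have yX: "y \<in> X"
    unfolding y_def
    by (intro geodesically_convex_segment[OF X(2,3) PX segment_between_seg] mult_nonneg_nonneg l) auto
  have "dist y (r s) \<le> s / t * dist (P t) (r t)"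
    using thales[OF segment_between_seg[of "r 0" "P t"]
      is_ray_segment[OF r less_imp_le[OF l(3)]] l(1,2)]
      ray_origin_dist[OF r, of t] l by (simp add: y_def)
  then have "(dist y (r s))\<^sup>2 \<le> (s / t * dist (P t) (r t))\<^sup>2" by (intro power_mono) auto
  moreover have "(dist (r s) (P s))\<^sup>2 + (dist (P s) y)\<^sup>2 \<le> (dist (r s) y)\<^sup>2"
    unfolding P_def by (rule nearest_pythagoras[OF X(2) nearest_point[OF X(1,2) ne] yX])
  ultimately show ?thesis by (simp add: y_def P_def dist_commute)
qed

text \<open>Since \<open>c < 1\<close>, the distance of the projections from \<open>r 0\<close>
  grows at least linearly, so errors small against \<open>s\<close> are small against this distance
  too.\<close>

lemma projected_ray_limit:
  fixes X :: "'a::hadamard_space set"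
  assumes X: "closed X" "geodesically_convex X" "r 0 \<in> X" and r: "is_ray r"
    and c: "0 \<le> c" "c < 1" "\<And>t. 0 < t \<Longrightarrow> dist (r t) (nearest_point X (r t)) \<le> c * t"
  obtains x where "is_ray x" "x 0 = r 0" "\<And>u. 0 \<le> u \<Longrightarrow> x u \<in> X"
    "filterlim (\<lambda>t. dist (r 0) (nearest_point X (r t))) at_top at_top"
    "\<And>T. 0 \<le> T \<Longrightarrow> uniform_limit {0..T} (\<lambda>t. seg (r 0) (nearest_point X (r t))) x at_top"
    "\<And>e. 0 < e \<Longrightarrow> \<forall>\<^sub>F s in at_top. dist (nearest_point X (r s)) (x (dist (r 0) (nearest_point X (r s))))
       \<le> e * dist (r 0) (nearest_point X (r s))"
proof -
  define P where "P t = nearest_point X (r t)" for t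
  define D where "D t = dist (r 0) (P t)" for t
  define g where "g t = dist (r t) (P t) / t" for t
  define k where "k = 1 - c"
  have k: "0 < k" using c by (simp add: k_def)
  have ne: "X \<noteq> {}" using X by blast
  have PX: "P t \<in> X" for t using nearest_point(1)[OF X(1,2) ne] by (simp add: P_def)
  have g: "0 \<le> g t" "g t \<le> c" if "0 < t" for t
    using c(3)[OF that] that by (auto simp: g_def P_def pos_divide_le_eq)
  have Dk: "k * t \<le> D t" if "0 < t" for t
    using c(3)[OF that] ray_origin_dist[OF r, of t] that dist_triangle[of "r 0" "r t" "P t"]
    by (simp add: k_def D_def P_def dist_commute algebra_simps)
  have far: "filterlim D at_top at_top"
  proof (rule filterlim_at_top_mono)
    show "filterlim (\<lambda>t. k * t) at_top at_top" using k by real_asymp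
    show "\<forall>\<^sub>F t in at_top. k * t \<le> D t"
      by (rule eventually_mono[OF eventually_gt_at_top[of 0] Dk])
  qed
  have step: "(dist (seg (r 0) (P t) (s / t * D t)) (P s))\<^sup>2 \<le> s\<^sup>2 * ((g t)\<^sup>2 - (g s)\<^sup>2)"
    if st: "0 < s" "s \<le> t" for s t
  proof -
    have "(s / t * dist (r t) (P t))\<^sup>2 - (dist (r s) (P s))\<^sup>2 = s\<^sup>2 * ((g t)\<^sup>2 - (g s)\<^sup>2)"
      using st by (simp add: g_def power_divide power_mult_distrib right_diff_distrib)
    then show ?thesis
      using dist_seg_projection_le[OF X r st] by (simp add: P_def D_def)
  qed
  \<comment> \<open>The left side of \<open>step\<close> is a square, so the difference on its right
    is not negative.\<close>
  have mono: "(g s)\<^sup>2 \<le> (g t)\<^sup>2" if st: "0 < s" "s \<le> t" for s t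
  proof -
    have "0 \<le> s\<^sup>2 * ((g t)\<^sup>2 - (g s)\<^sup>2)" using step[OF st] zero_le_power2 order_trans by blast
    then show ?thesis using st by (simp add: zero_le_mult_iff)
  qed
  obtain L where L: "((\<lambda>t. - (g t)\<^sup>2) \<longlongrightarrow> L) at_top" "\<And>t. 0 < t \<Longrightarrow> L \<le> - (g t)\<^sup>2"
  proof (rule antimono_tendsto_at_top[of 0 "\<lambda>t. - (g t)\<^sup>2" "- c\<^sup>2"])
    show "- (g t)\<^sup>2 \<le> - (g s)\<^sup>2" if "0 < s" "s \<le> t" for s t using mono[OF that] by simp
    show "- c\<^sup>2 \<le> - (g t)\<^sup>2" if "0 < t" for t using g[OF that] by (simp add: power_mono)
  qed blast
  obtain x where x: "is_ray x" "x 0 = r 0" 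
    "\<And>T. 0 \<le> T \<Longrightarrow> uniform_limit {0..T} (\<lambda>t. seg (r 0) (P t)) x at_top"
    "\<And>e. 0 < e \<Longrightarrow> \<forall>\<^sub>F s in at_top. dist (P s) (x (dist (r 0) (P s))) \<le> e * dist (r 0) (P s)"
  proof (rule segments_limit[of "r 0" P])
    show "filterlim (\<lambda>t. dist (r 0) (P t)) at_top at_top" using far by (simp add: D_def[abs_def])
    fix e :: real assume e: "0 < e"
    \<comment> \<open>The factor \<open>k\<close> is for the bound \<open>k * s \<le> D s\<close>,
      and the 2 is for the two errors of size \<open>e * u / 2\<close> added at the end.\<close>
    have "\<forall>\<^sub>F t in at_top. - (g t)\<^sup>2 < L + (k * e / 2)\<^sup>2"
      by (rule order_tendstoD(2)[OF L(1)]) (use e k in simp)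
    then have "\<forall>\<^sub>F t in at_top. - (g t)\<^sup>2 < L + (k * e / 2)\<^sup>2 \<and> 0 < t"
      using eventually_gt_at_top[of 0] by (rule eventually_conj)
    then obtain N where N: "\<And>t. N \<le> t \<Longrightarrow> - (g t)\<^sup>2 < L + (k * e / 2)\<^sup>2 \<and> 0 < t"
      unfolding eventually_at_top_linorder by blast
    have "dist (seg (r 0) (P s) u) (seg (r 0) (P t) u) \<le> e * u"
      if *: "N \<le> s" "s \<le> t" "0 \<le> u" "u \<le> D s" "u \<le> D t" for s t u
    proof -
      \<comment> \<open>The parameters \<open>b\<close> of \<open>y\<close> and \<open>D s\<close>
        of \<open>P s\<close> need not agree. So the segments are first compared at the common
        fraction \<open>u / D s\<close>, and then the parameter \<open>u / D s * b\<close> is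
        corrected to \<open>u\<close>.\<close>
      define b where "b = s / t * D t"
      define y where "y = seg (r 0) (P t) b"
      have st: "0 < s" "0 < t" using N * by auto
      then have D0: "0 < D s" using Dk[of s] k by (meson less_le_trans mult_pos_pos)
      have "s / t * D t \<le> D t"
        using st * by (intro mult_left_le_one_le) (auto simp: D_def)
      then have b: "0 \<le> b" "b \<le> D t" using st by (simp_all add: b_def D_def)
      have y0: "dist (r 0) y = b"
        using segment_between_dist(1)[OF segment_between_seg, of b "r 0" "P t"] b by (simp add: y_def D_def)
      have "(g t)\<^sup>2 - (g s)\<^sup>2 \<le> (k * e / 2)\<^sup>2"
        using N[of s] L(2)[OF st(2)] * by auto
      then have "s\<^sup>2 * ((g t)\<^sup>2 - (g s)\<^sup>2) \<le> s\<^sup>2 * (k * e / 2)\<^sup>2" by (intro mult_left_mono) auto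
      then have "(dist y (P s))\<^sup>2 \<le> (s * (k * e / 2))\<^sup>2"
        using step[OF st(1) *(2)] unfolding power_mult_distrib[of s] y_def b_def
        by (rule order_trans[rotated])
      then have "dist y (P s) \<le> s * (k * e / 2)"
        by (rule power2_le_imp_le) (use st k e in simp)
      also have "\<dots> = e / 2 * (k * s)" by simp
      also have "\<dots> \<le> e / 2 * D s" using Dk[OF st(1)] e by (intro mult_left_mono) auto
      finally have yP: "dist y (P s) \<le> e / 2 * D s" .
      have l: "0 \<le> u / D s" "u / D s \<le> 1" using * D0 by auto
      have "u / D s * dist y (P s) \<le> u / D s * (e / 2 * D s)"
        using yP l by (intro mult_left_mono) auto
      then have le: "u / D s * dist y (P s) \<le> (e * u) / 2" using D0 by (simp add: mult.commute)
      have "segment_between (r 0) y (seg (r 0) (P t))"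
        unfolding y_def using b
        by (intro segment_between_restrict[OF segment_between_seg]) (auto simp: D_def)
      from thales[OF segment_between_seg[of _ "P s"] this l]
      have "dist (seg (r 0) (P s) (u / D s * D s)) (seg (r 0) (P t) (u / D s * b))
          \<le> u / D s * dist (P s) y"
        unfolding y0 D_def .
      then have 1: "dist (seg (r 0) (P s) u) (seg (r 0) (P t) (u / D s * b)) \<le> u / D s * dist y (P s)"
        using D0 by (simp add: dist_commute)
      have "u / D s * b \<le> b" using l b by (intro mult_left_le_one_le) auto
      then have "dist (seg (r 0) (P t) (u / D s * b)) (seg (r 0) (P t) u) = \<bar>u / D s * b - u\<bar>"
        using segment_between_seg[of "r 0" "P t"] l b * by (simp add: segment_between_def D_def)
      \<comment> \<open>The numbers \<open>b\<close> and \<open>D s\<close> are the distances of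
        \<open>y\<close> and \<open>P s\<close> from \<open>r 0\<close>, so the distance between
        these points bounds the parameter error as well.\<close>
      also have "\<bar>u / D s * b - u\<bar> \<le> u / D s * dist y (P s)"
      proof -
        have "u / D s * b - u = u / D s * (b - D s)" using D0 by (simp add: field_simps)
        moreover have "\<bar>b - D s\<bar> \<le> dist y (P s)"
          using abs_dist_diff_le[of y "r 0" "P s"] y0 by (simp add: D_def dist_commute)
        ultimately show ?thesis using l by (simp only: abs_mult abs_of_nonneg mult_left_mono)
      qed
      finally have 2: "dist (seg (r 0) (P t) (u / D s * b)) (seg (r 0) (P t) u) \<le> u / D s * dist y (P s)" .
      have "dist (seg (r 0) (P s) u) (seg (r 0) (P t) u) \<le> e * u / 2 + e * u / 2"
        by (rule order_trans[OF dist_triangle add_mono[OF order_trans[OF 1 le] order_trans[OF 2 le]]])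
      then show ?thesis by simp
    qed
    then show "\<exists>N. \<forall>s t u. N \<le> s \<and> s \<le> t \<and> 0 \<le> u \<and> u \<le> dist (r 0) (P s) \<and>
      u \<le> dist (r 0) (P t) \<longrightarrow> dist (seg (r 0) (P s) u) (seg (r 0) (P t) u) \<le> e * u"
      unfolding D_def by blast
  qed blast
  have far': "filterlim (\<lambda>t. dist (r 0) (P t)) at_top at_top" using far by (simp add: D_def[abs_def])
  have "x u \<in> X" if "0 \<le> u" for u
    using limit_ray_in_set[OF X PX far' x(3) that] by blast
  then show ?thesis using that x far' unfolding P_def by blast
qed

section \<open>Minimising the Tits angle over the boundary of \<open>X\<close>\<close>

text \<open>The competitor for the projection is the point of the ray in \<open>X\<close> at the
  parameter \<open>t * cos (tits_angle \<eta> \<xi>)\<close>, where the foot of the perpendicular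
  would be in a Euclidean sector. Comparison angles do not exceed the Tits angle, so it is no
  farther away than in the sector.\<close>

lemma dist_projection_le_of_tits_angle:
  fixes X :: "'a::hadamard_space set"
  assumes X: "closed X" "geodesically_convex X" "x0 \<in> X"
    and \<eta>: "\<eta> \<in> ideal_boundary UNIV" and \<xi>: "\<xi> \<in> ideal_boundary X"
    and less: "tits_angle \<eta> \<xi> < pi / 2" and t: "0 < t"
  shows "dist (ray_from x0 \<eta> t) (nearest_point X (ray_from x0 \<eta> t)) \<le> sin (tits_angle \<eta> \<xi>) * t"
proof (rule power2_le_imp_le)
  define r where "r = ray_from x0 \<eta>"
  define y where "y = ray_from x0 \<xi>"
  define c where "c = cos (tits_angle \<eta> \<xi>)"
  note T = tits_angle[OF \<eta> \<xi>]
  have c: "0 < c" unfolding c_def using T(1) less by (intro cos_gt_zero_pi) auto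
  have r: "is_ray r" "r 0 = x0" and y: "is_ray y" "y 0 = x0"
    using ray_from[OF \<eta>] ray_from[OF \<xi>] by (auto simp: r_def y_def)
  define u where "u = t * c"
  have u: "0 < u" using t c by (simp add: u_def)
  have yX: "y u \<in> X" using ray_from_in_set[OF X \<xi>] u by (simp add: y_def)
  have "dist (r t) (nearest_point X (r t)) \<le> dist (r t) (y u)"
    using X by (intro nearest_point yX) auto
  then have "(dist (r t) (nearest_point X (r t)))\<^sup>2 \<le> (dist (r t) (y u))\<^sup>2"
    by (simp add: power_mono)
  also have "\<dots> = t\<^sup>2 + u\<^sup>2 - 2 * comparison_inner x0 (r t) (y u)"
    using dist_sq_comparison_inner[of "r t" "y u" x0] ray_origin_dist[OF r(1), of t]
      ray_origin_dist[OF y(1), of u] r y t u by simp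
  also have "\<dots> \<le> t\<^sup>2 + u\<^sup>2 - 2 * (t * u * c)"
  proof -
    have "c \<le> comparison_inner x0 (r t) (y u) / (t * u)"
      using T(3)[OF t u, of x0] r by (simp add: ray_cos_def c_def r_def y_def)
    then show ?thesis using t u by (simp add: pos_le_divide_eq mult.commute)
  qed
  also have "\<dots> = (1 - c\<^sup>2) * t\<^sup>2" by (simp add: u_def power2_eq_square algebra_simps)
  also have "\<dots> = (sin (tits_angle \<eta> \<xi>) * t)\<^sup>2"
    by (simp add: c_def cos_squared_eq power_mult_distrib)
  finally show "(dist (ray_from x0 \<eta> t) (nearest_point X (ray_from x0 \<eta> t)))\<^sup>2 \<le> (sin (tits_angle \<eta> \<xi>) * t)\<^sup>2"
    by (simp add: r_def)
  show "0 \<le> sin (tits_angle \<eta> \<xi>) * t" using T(1,2) t by (simp add: sin_ge_zero)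
qed

text \<open>By the projection inequality, \<open>x\<close> is almost the best direction in \<open>X\<close>
  at the scale of \<open>p\<close>.\<close>

lemma ray_cos_projection_le:
  fixes r x y :: "real \<Rightarrow> 'a::hadamard_space"
  assumes r: "is_ray r" "is_ray x" "is_ray y" "x 0 = r 0" "y 0 = r 0" and s: "0 < s"
    and p: "\<And>z. z \<in> X \<Longrightarrow> (dist (r s) p)\<^sup>2 + (dist p z)\<^sup>2 \<le> (dist (r s) z)\<^sup>2"
    and X: "r 0 \<in> X" "y (dist (r 0) p) \<in> X" and D: "0 < dist (r 0) p"
    and w: "w = dist p (x (dist (r 0) p)) / dist (r 0) p"
  shows "ray_cos r y s (dist (r 0) p) + (dist p (y (dist (r 0) p)))\<^sup>2 / (2 * s * dist (r 0) p)
    \<le> ray_cos r x s (dist (r 0) p) + w + w\<^sup>2 / 2"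
proof -
  define D where "D = dist (r 0) p"
  define h where "h = dist (r s) p"
  have D0: "0 < D" using assms by (simp add: D_def)
  have w': "dist p (x D) = w * D" "0 \<le> w" using D0 by (simp_all add: w D_def)
  have d: "dist (r 0) (r s) = s" "dist (r 0) (x D) = D" "dist (r 0) (y D) = D"
    using ray_origin_dist[OF r(1), of s] ray_origin_dist[OF r(2), of D]
      ray_origin_dist[OF r(3), of D] r s D0 by auto
  \<comment> \<open>The vertex \<open>r 0\<close> as competitor yields \<open>h \<le> s\<close> and
    \<open>D \<le> s\<close>, which turn all error terms into multiples of \<open>s * D\<close>, the
    denominator of the cosine.\<close>
  have "h\<^sup>2 + D\<^sup>2 \<le> s\<^sup>2" using p[OF X(1)] d(1) by (simp add: h_def D_def dist_commute)
  then have "h\<^sup>2 \<le> s\<^sup>2" "D\<^sup>2 \<le> s\<^sup>2"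
    using zero_le_power2[of D] zero_le_power2[of h] by linarith+
  then have hs: "h \<le> s" "D \<le> s" using s by (auto intro: power2_le_imp_le)
  have h0: "0 \<le> h" by (simp add: h_def)
  have "dist (r s) (x D) \<le> h + w * D"
    using dist_triangle[of "r s" "x D" p] w' by (simp add: h_def)
  then have "(dist (r s) (x D))\<^sup>2 \<le> (h + w * D)\<^sup>2" by (intro power_mono) auto
  also have "\<dots> = h\<^sup>2 + 2 * (h * (w * D)) + w\<^sup>2 * (D * D)" by (simp add: power2_eq_square algebra_simps)
  also have "\<dots> \<le> h\<^sup>2 + 2 * (s * (w * D)) + w\<^sup>2 * (s * D)"
    using hs h0 D0 w' by (intro add_mono mult_left_mono mult_right_mono) auto
  finally have "(dist (r s) (x D))\<^sup>2 + (dist p (y D))\<^sup>2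
      \<le> (dist (r s) (y D))\<^sup>2 + 2 * (s * (w * D)) + w\<^sup>2 * (s * D)"
    using p[OF X(2)] by (simp add: h_def D_def)
  \<comment> \<open>The points \<open>x D\<close> and \<open>y D\<close> are equally far from
    \<open>r 0\<close>, so squared distances to \<open>r s\<close> may be traded for inner
    products.\<close>
  then have "comparison_inner (r 0) (r s) (y D) + (dist p (y D))\<^sup>2 / 2
      \<le> comparison_inner (r 0) (r s) (x D) + (w + w\<^sup>2 / 2) * (s * D)"
    unfolding comparison_inner_def d by (simp add: field_simps)
  then have "(comparison_inner (r 0) (r s) (y D) + (dist p (y D))\<^sup>2 / 2) / (s * D)
      \<le> (comparison_inner (r 0) (r s) (x D) + (w + w\<^sup>2 / 2) * (s * D)) / (s * D)"
    using s D0 by (intro divide_right_mono) auto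
  then show ?thesis
    using s D0 unfolding ray_cos_def D_def[symmetric] by (simp add: add_divide_distrib mult_ac)
qed

text \<open>The intercept inequality carries the distance at the large parameter \<open>D s\<close>
  back to \<open>v\<close> with the factor \<open>v / D s\<close>.\<close>

lemma rays_eq_of_sublinear:
  assumes r: "is_ray x" "is_ray y" "x 0 = y 0" and v: "0 \<le> v"
    and D: "filterlim D at_top F" and F: "F \<noteq> bot"
    and lim: "((\<lambda>s. dist (x (D s)) (y (D s)) / D s) \<longlongrightarrow> 0) F"
  shows "x v = y v"
proof -
  have "((\<lambda>s. v * (dist (x (D s)) (y (D s)) / D s)) \<longlongrightarrow> v * 0) F"
    by (intro tendsto_intros lim)
  moreover have "\<forall>\<^sub>F s in F. max v 1 \<le> D s"
    using D unfolding filterlim_at_top by blast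
  then have "\<forall>\<^sub>F s in F. dist (x v) (y v) \<le> v * (dist (x (D s)) (y (D s)) / D s)"
  proof eventually_elim
    case (elim s)
    then show ?case using ray_thales[OF r v, of "D s"] by simp
  qed
  ultimately have "dist (x v) (y v) \<le> v * 0" using F by (rule tendsto_lowerbound)
  then show ?thesis by simp
qed

lemma tits_angle_projection:
  fixes X :: "'a::hadamard_space set"
  assumes X: "closed X" "geodesically_convex X" "x0 \<in> X"
    and \<eta>: "\<eta> \<in> ideal_boundary UNIV" and \<xi>0: "\<xi>0 \<in> ideal_boundary X" "tits_angle \<eta> \<xi>0 < pi / 2"
  obtains \<xi> where "\<xi> \<in> ideal_boundary X"
    "\<And>\<xi>'. \<xi>' \<in> ideal_boundary X \<Longrightarrow> tits_angle \<eta> \<xi> \<le> tits_angle \<eta> \<xi>'"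
    "\<And>\<xi>'. \<xi>' \<in> ideal_boundary X \<Longrightarrow> tits_angle \<eta> \<xi>' = tits_angle \<eta> \<xi> \<Longrightarrow> \<xi>' = \<xi>"
    "segments_converge_to_ray x0 (\<lambda>t. nearest_point X (ray_from x0 \<eta> t)) \<xi>"
proof -
  define r where "r = ray_from x0 \<eta>"
  define P where "P t = nearest_point X (r t)" for t
  define D where "D t = dist x0 (P t)" for t
  have ne: "X \<noteq> {}" using X by blast
  have PX: "P t \<in> X" for t using nearest_point(1)[OF X(1,2) ne] by (simp add: P_def)
  have r: "is_ray r" "r 0 = x0" using ray_from[OF \<eta>] by (auto simp: r_def)
  define \<theta> where "\<theta> = tits_angle \<eta> \<xi>0"
  have \<theta>: "0 \<le> \<theta>" "\<theta> < pi / 2" using tits_angle(1)[OF \<eta> \<xi>0(1)] \<xi>0(2) by (auto simp: \<theta>_def)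
  have c: "0 \<le> sin \<theta>" "sin \<theta> < 1"
    using \<theta> sin_monotone_2pi[of \<theta> "pi / 2"] by (auto intro: sin_ge_zero)
  have h: "dist (r t) (P t) \<le> sin \<theta> * t" if "0 < t" for t
    using dist_projection_le_of_tits_angle[OF X \<eta> \<xi>0 that] by (simp add: r_def P_def \<theta>_def)
  obtain x where x: "is_ray x" "x 0 = x0" "\<And>u. 0 \<le> u \<Longrightarrow> x u \<in> X" and far: "filterlim D at_top at_top"
    and unif: "\<And>T. 0 \<le> T \<Longrightarrow> uniform_limit {0..T} (\<lambda>t. seg x0 (P t)) x at_top"
    and close: "\<And>e. 0 < e \<Longrightarrow> \<forall>\<^sub>F s in at_top. dist (P s) (x (D s)) \<le> e * D s"
    using projected_ray_limit[OF X(1,2) X(3)[folded r(2)] r(1) c h[unfolded P_def],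
        unfolded r(2), folded P_def, folded D_def] by blast
  define \<xi> where "\<xi> = asymptotic `` {x}"
  have \<xi>: "\<xi> \<in> ideal_boundary X"
    unfolding \<xi>_def ideal_boundary_def using x by (intro quotientI) auto
  have "x \<in> \<xi>" using equiv_class_self[OF equiv_asymptotic] x by (auto simp: \<xi>_def)
  then have x_eq: "ray_from x0 \<xi> t = x t" if "0 \<le> t" for t
    using ray_from_eq[OF \<xi> _ that, of x] x by simp
  define w where "w s = dist (P s) (x (D s)) / D s" for s
  have Dpos: "\<forall>\<^sub>F s in at_top. 0 < D s"
    using far by (simp add: filterlim_at_top_dense)
  have w: "(w \<longlongrightarrow> 0) at_top"
  proof (rule tendstoI)
    fix e :: real assume e: "0 < e"
    then have "\<forall>\<^sub>F s in at_top. dist (P s) (x (D s)) \<le> e / 2 * D s" by (intro close) simp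
    then show "\<forall>\<^sub>F s in at_top. dist (w s) 0 < e"
      using Dpos
    proof eventually_elim
      case (elim s)
      then have "w s \<le> e / 2" by (simp add: w_def pos_divide_le_eq)
      moreover have "0 \<le> w s" using elim by (simp add: w_def)
      ultimately show ?case using e by simp
    qed
  qed
  \<comment> \<open>The two-variable limit may be evaluated along this curve, on which the point of
    the ray in \<open>X\<close> is as far from \<open>x0\<close> as \<open>P s\<close>.\<close>
  have pair: "filterlim (\<lambda>s. (s, D s)) (at_top \<times>\<^sub>F at_top) at_top"
    by (intro filterlim_Pair filterlim_ident far)
  have cos_lim: "((\<lambda>s. ray_cos r (ray_from x0 \<zeta>) s (D s)) \<longlongrightarrow> cos (tits_angle \<eta> \<zeta>)) at_top"
    if "\<zeta> \<in> ideal_boundary X" for \<zeta>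
    using filterlim_compose[OF tits_angle(4)[OF \<eta> that, of x0] pair] by (simp add: r_def)
  \<comment> \<open>For minimality the square term is simply dropped; for uniqueness it is what gets
    squeezed to zero.\<close>
  have key: "\<forall>\<^sub>F s in at_top. 0 < s \<and> 0 < D s \<and> ray_cos r (ray_from x0 \<zeta>) s (D s)
      + (dist (P s) (ray_from x0 \<zeta> (D s)))\<^sup>2 / (2 * s * D s)
    \<le> ray_cos r (ray_from x0 \<xi>) s (D s) + w s + (w s)\<^sup>2 / 2"
    if \<zeta>: "\<zeta> \<in> ideal_boundary X" for \<zeta>
    using Dpos eventually_gt_at_top[of 0]
  proof eventually_elim
    case (elim s)
    have "(dist (r s) (P s))\<^sup>2 + (dist (P s) z)\<^sup>2 \<le> (dist (r s) z)\<^sup>2" if "z \<in> X" for z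
      unfolding P_def by (rule nearest_pythagoras[OF X(2) nearest_point[OF X(1,2) ne] that])
    moreover have "w s = dist (P s) (ray_from x0 \<xi> (D s)) / D s"
      using elim by (simp add: w_def x_eq)
    moreover have "ray_from x0 \<zeta> (D s) \<in> X"
      using ray_from_in_set[OF X \<zeta>] elim by simp
    ultimately show ?case
      using ray_cos_projection_le[of r "ray_from x0 \<xi>" "ray_from x0 \<zeta>" s X "P s" "w s"]
        r ray_from(2,3)[OF \<zeta>, of x0] ray_from(2,3)[OF \<xi>, of x0] elim X by (simp add: D_def)
  qed
  have slack: "((\<lambda>s. ray_cos r (ray_from x0 \<xi>) s (D s) + w s + (w s)\<^sup>2 / 2)
      \<longlongrightarrow> cos (tits_angle \<eta> \<xi>)) at_top"
    using tendsto_add[OF tendsto_add[OF cos_lim[OF \<xi>] w] tendsto_divide[OF tendsto_power[OF w, of 2] tendsto_const[of 2]]]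
    by simp
  have le: "tits_angle \<eta> \<xi> \<le> tits_angle \<eta> \<zeta>" if \<zeta>: "\<zeta> \<in> ideal_boundary X" for \<zeta>
  proof -
    have "cos (tits_angle \<eta> \<zeta>) \<le> cos (tits_angle \<eta> \<xi>)"
    proof (rule tendsto_le[OF _ slack cos_lim[OF \<zeta>]])
      show "\<forall>\<^sub>F s in at_top. ray_cos r (ray_from x0 \<zeta>) s (D s)
        \<le> ray_cos r (ray_from x0 \<xi>) s (D s) + w s + (w s)\<^sup>2 / 2"
        using key[OF \<zeta>]
      proof eventually_elim
        case (elim s)
        moreover have "0 \<le> (dist (P s) (ray_from x0 \<zeta> (D s)))\<^sup>2 / (2 * s * D s)" using elim by simp
        ultimately show ?case by linarith
      qed
    qed simp
    then show ?thesis
      using tits_angle(1,2)[OF \<eta> \<zeta>] tits_angle(1,2)[OF \<eta> \<xi>] by (simp add: cos_mono_le_eq)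
  qed
  \<comment> \<open>Equal angles give both cosines the same limit, so the competing ray stays
    sublinearly close to \<open>P s\<close>, and hence to the limit ray.\<close>
  have unique: "\<zeta> = \<xi>" if \<zeta>: "\<zeta> \<in> ideal_boundary X" and eq: "tits_angle \<eta> \<zeta> = tits_angle \<eta> \<xi>" for \<zeta>
  proof (rule ideal_boundary_eqI[OF \<zeta> \<xi>])
    let ?y = "ray_from x0 \<zeta>"
    define d where "d s = dist (P s) (?y (D s)) / D s" for s
    define k where "k = 1 - sin \<theta>"
    have k: "0 < k" using c by (simp add: k_def)
    have "((\<lambda>s. 2 / k * (ray_cos r (ray_from x0 \<xi>) s (D s) + w s + (w s)\<^sup>2 / 2 - ray_cos r ?y s (D s)))
        \<longlongrightarrow> 2 / k * (cos (tits_angle \<eta> \<xi>) - cos (tits_angle \<eta> \<zeta>))) at_top"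
      by (intro tendsto_mult tendsto_const tendsto_diff slack cos_lim \<zeta>)
    then have "((\<lambda>s. 2 / k * (ray_cos r (ray_from x0 \<xi>) s (D s) + w s + (w s)\<^sup>2 / 2 - ray_cos r ?y s (D s)))
        \<longlongrightarrow> 0) at_top" by (simp add: eq)
    moreover have "\<forall>\<^sub>F s in at_top. norm ((d s)\<^sup>2)
      \<le> 2 / k * (ray_cos r (ray_from x0 \<xi>) s (D s) + w s + (w s)\<^sup>2 / 2 - ray_cos r ?y s (D s))"
      using key[OF \<zeta>]
    proof eventually_elim
      case (elim s)
      define E where "E = (dist (P s) (?y (D s)))\<^sup>2"
      \<comment> \<open>This trades the denominator \<open>s * D s\<close> for the square of
        \<open>D s\<close> at the cost of a factor \<open>1 / k\<close>.\<close>
      have "k * s \<le> D s"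
        using h[of s] ray_origin_dist[OF r(1), of s] elim r dist_triangle[of x0 "r s" "P s"]
        by (simp add: k_def D_def dist_commute algebra_simps)
      then have "E * (k * s) \<le> E * D s" by (intro mult_left_mono) (auto simp: E_def)
      then have "E / (D s)\<^sup>2 \<le> 2 / k * (E / (2 * s * D s))"
        using elim k by (simp add: field_simps power2_eq_square)
      also have "\<dots> \<le> 2 / k * (ray_cos r (ray_from x0 \<xi>) s (D s) + w s + (w s)\<^sup>2 / 2 - ray_cos r ?y s (D s))"
        using elim k by (intro mult_left_mono) (auto simp: E_def)
      finally show ?case by (simp add: d_def E_def power_divide)
    qed
    ultimately have "((\<lambda>s. (d s)\<^sup>2) \<longlongrightarrow> 0) at_top" by (rule Lim_null_comparison[rotated])
    then have d: "(d \<longlongrightarrow> 0) at_top" by simp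
    have "((\<lambda>s. dist (?y (D s)) (ray_from x0 \<xi> (D s)) / D s) \<longlongrightarrow> 0) at_top"
    proof (rule Lim_null_comparison)
      show "((\<lambda>s. d s + w s) \<longlongrightarrow> 0) at_top" using tendsto_add[OF d w] by simp
      show "\<forall>\<^sub>F s in at_top. norm (dist (?y (D s)) (ray_from x0 \<xi> (D s)) / D s) \<le> d s + w s"
        using Dpos
      proof eventually_elim
        case (elim s)
        have "dist (?y (D s)) (x (D s)) \<le> dist (P s) (?y (D s)) + dist (P s) (x (D s))"
          by (rule dist_triangle3)
        then show ?case
          using elim by (simp add: d_def w_def x_eq add_divide_distrib[symmetric] divide_right_mono)
      qed
    qed
    then show "?y t = ray_from x0 \<xi> t" if "0 \<le> t" for t
      using rays_eq_of_sublinear[OF ray_from(3)[OF \<zeta>] ray_from(3)[OF \<xi>] _ that far, of x0 x0]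
        ray_from(2)[OF \<zeta>, of x0] ray_from(2)[OF \<xi>, of x0] by simp
  qed
  have "segments_converge_to_ray x0 P \<xi>"
    unfolding segments_converge_to_ray_def
  proof (intro conjI allI impI)
    show "filterlim (\<lambda>t. dist x0 (P t)) at_top at_top" using far by (simp add: D_def[abs_def])
    show "uniform_limit {0..T} (\<lambda>t. seg x0 (P t)) (ray_from x0 \<xi>) at_top" if "0 \<le> T" for T
      using unif[OF that] by (subst uniform_limit_cong'[of "{0..T}" _ "\<lambda>t. seg x0 (P t)" _ x]) (auto simp: x_eq)
  qed
  moreover have "P = (\<lambda>t. nearest_point X (ray_from x0 \<eta> t))" by (simp add: P_def[abs_def] r_def)
  ultimately show ?thesis using that \<xi> le unique by blast
qed

theorem mainTheorem3:
  fixes X :: "'a::hadamard_space set" and x0 :: 'a and \<eta> :: "(real \<Rightarrow> 'a) set"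
  assumes "closed X" and "geodesically_convex X" and "x0 \<in> X"
    and "\<eta> \<in> ideal_boundary UNIV"
  shows
    "(tits_angle_to_set \<eta> (ideal_boundary X) < ereal (pi / 2) \<longrightarrow>
       (\<exists>\<xi>\<in>ideal_boundary X.
          ereal (tits_angle \<eta> \<xi>) = tits_angle_to_set \<eta> (ideal_boundary X) \<and>
          (\<forall>\<xi>'\<in>ideal_boundary X.
             ereal (tits_angle \<eta> \<xi>') = tits_angle_to_set \<eta> (ideal_boundary X) \<longrightarrow> \<xi>' = \<xi>) \<and>
          segments_converge_to_ray x0 (\<lambda>t. nearest_point X (ray_from x0 \<eta> t)) \<xi>)) \<and>
     (bounded ((\<lambda>t. nearest_point X (ray_from x0 \<eta> t)) ` {0..}) \<longrightarrow>
       (\<exists>p\<in>X. \<forall>t>0. nearest_point X (ray_from p \<eta> t) = p))"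
proof (intro conjI impI)
  assume "tits_angle_to_set \<eta> (ideal_boundary X) < ereal (pi / 2)"
  \<comment> \<open>An infimum below \<open>pi / 2\<close> supplies such a point; over an empty
    boundary it would be infinite.\<close>
  then obtain \<xi>0 where \<xi>0: "\<xi>0 \<in> ideal_boundary X" "tits_angle \<eta> \<xi>0 < pi / 2"
    by (auto simp: tits_angle_to_set_def INF_less_iff)
  obtain \<xi> where \<xi>: "\<xi> \<in> ideal_boundary X"
    "\<And>\<xi>'. \<xi>' \<in> ideal_boundary X \<Longrightarrow> tits_angle \<eta> \<xi> \<le> tits_angle \<eta> \<xi>'"
    "\<And>\<xi>'. \<xi>' \<in> ideal_boundary X \<Longrightarrow> tits_angle \<eta> \<xi>' = tits_angle \<eta> \<xi> \<Longrightarrow> \<xi>' = \<xi>"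
    "segments_converge_to_ray x0 (\<lambda>t. nearest_point X (ray_from x0 \<eta> t)) \<xi>"
    using tits_angle_projection[OF assms \<xi>0] by metis
  have inf: "tits_angle_to_set \<eta> (ideal_boundary X) = ereal (tits_angle \<eta> \<xi>)"
    unfolding tits_angle_to_set_def using \<xi>(1,2)
    by (intro antisym INF_lower INF_greatest) auto
  show "\<exists>\<xi>\<in>ideal_boundary X.
          ereal (tits_angle \<eta> \<xi>) = tits_angle_to_set \<eta> (ideal_boundary X) \<and>
          (\<forall>\<xi>'\<in>ideal_boundary X.
             ereal (tits_angle \<eta> \<xi>') = tits_angle_to_set \<eta> (ideal_boundary X) \<longrightarrow> \<xi>' = \<xi>) \<and>
          segments_converge_to_ray x0 (\<lambda>t. nearest_point X (ray_from x0 \<eta> t)) \<xi>"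
    using \<xi> by (intro bexI[of _ \<xi>]) (auto simp: inf)
qed (rule bounded_projection_fixed_point[OF assms])

end
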